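(* Let $$\mathcal{A}=\begin{pmatrix}\tau A & M\\ M & -\tau B\end{pmatrix},\qquad \tilde{\mathcal{B}}=\begin{pmatrix}\tau A & M\\ \bar M & -\tau B\end{pmatrix}.$$ There exists a positive constant $C$, independent of $h$ and $\tau$, such that if $\tau\ge Ch^2$, then the spectral radius of $\tilde{\mathcal{B}}^{-1}\mathcal{A}$ satisfies $$\rho(\tilde{\mathcal{B}}^{-1}\mathcal{A})<2,$$ and the GMRes method for the preconditioned system with matrix $R=\mathcal{A}\tilde{\mathcal{B}}^{-1}$ converges with an asymptotic linear convergence rate bounded by $$\tilde\theta=\frac{\rho(\tilde{\mathcal{B}}^{-1}\mathcal{A})}{2}.$$
   Context: Let $\Omega\subset\mathbb{R}^d$, $d\ge 1$, be a bounded polyhedral domain. The diffusion coefficients $a(x),b(x)$ are measurable (scalar, or symmetric matrix valued) functions on $\Omega$ satisfying the continuity and coercivity conditions $\lambda_a(x)|\xi|^2\le \xi^Ta(x)\xi\le\Lambda_a(x)|\xi|^2$ and $\lambda_b(x)|\xi|^2\le \xi^Tb(x)\xi\le\Lambda_b(x)|\xi|^2$ for all $\xi\in\mathbb{R}^d$, where $\lambda_a,\lambda_b$ are bounded below by positive constants and $\Lambda_a,\Lambda_b$ are bounded above. Let $\mathcal{T}$ be a shape-regular triangulation of $\Omega$ with meshsize $h$ (the shape-regularity constant being fixed as $h$ varies), and let $\mathbb{V}_{\mathcal{T}}\subset H^1_0(\Omega)$ be the space of continuous piecewise linear finite element functions over $\mathcal{T}$ vanishing on $\partial\Omega$, with nodal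 basis $\phi_1,\dots,\phi_{N_h}$, $N_h=\dim\mathbb{V}_{\mathcal{T}}$. Define the $N_h\times N_h$ matrices $$M_{ij}=\int_\Omega\phi_i\phi_j,\quad A_{ij}=\int_\Omega a\nabla\phi_i\cdot\nabla\phi_j,\quad B_{ij}=\int_\Omega b\nabla\phi_i\cdot\nabla\phi_j .$$ The lumped mass matrix $\bar M$ is the diagonal matrix whose diagonal entries are the row sums of $M$. The parameter $\tau>0$ is the square root of the time-step size. "Independent of $h$ and $\tau$" means that the constant may depend only on $\Omega$, the diffusion coefficients and the shape regularity of the triangulations. $\rho(\cdot)$ denotes spectral radius. GMRes: to solve $Rv=b$, start from an initial iterate $v_0$ with residual $r_0=b-Rv_0$; the residuals $r_k=b-Rv_k$ of the iterates $v_k$ satisfy $\|r_k\|_2=\min\{\|p(R)r_0\|_2: p \text{ a polynomial of degree}\le k,\ p(0)=1\}$, with $\|\cdot\|_2$ the Euclidean norm. "Asymptotic linear convergence rate bounded by $\theta$" means $\|r_k\|_2\le c\,\theta^k\|r_0\|_2$ for all $k$ with a constant $c$ independent of $k$. *)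

theory Defs
  imports
    "HOL-Analysis.Analysis"
    "Jordan_Normal_Form.Gauss_Jordan_Elimination"
    "Jordan_Normal_Form.Spectral_Radius"
begin

text \<open>
  Points of the domain and diffusion matrices have the types \<open>real^'d\<close> and \<open>real^'d^'d\<close> of
  HOL-Analysis; objects whose size is the number of unknowns are \<open>real mat\<close> and \<open>real vec\<close> of
  Jordan_Normal_Form. The infix dot is reserved for the latter.
\<close>

unbundle no inner_syntax

section \<open>Domain and coefficients\<close>

text \<open>Re-entrant corners and cracks are allowed, so the domain need not be Lipschitz.\<close>

definition polyhedral_domain :: "(real^'d) set \<Rightarrow> bool" where
  "polyhedral_domain \<Omega> \<longleftrightarrow>
     \<Omega> \<noteq> {} \<and> open \<Omega> \<and> connected \<Omega> \<and> bounded \<Omega> \<and>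
     (\<exists>\<P>. finite \<P> \<and> (\<forall>P\<in>\<P>. polytope P \<and> aff_dim P = int CARD('d) - 1) \<and> frontier \<Omega> = \<Union>\<P>)"

text \<open>A scalar coefficient \<open>\<alpha>\<close> is the special case of the multiple \<open>\<alpha> x\<close> of the identity matrix.\<close>

definition diffusion_coefficient :: "(real^'d) set \<Rightarrow> (real^'d \<Rightarrow> real^'d^'d) \<Rightarrow> bool" where
  "diffusion_coefficient \<Omega> a \<longleftrightarrow>
     a \<in> borel_measurable (lebesgue_on \<Omega>) \<and>
     (\<forall>x\<in>\<Omega>. transpose (a x) = a x) \<and>
     (\<exists>lam Lam :: real^'d \<Rightarrow> real. \<exists>\<alpha> \<beta>. 0 < \<alpha> \<and>
        (\<forall>x\<in>\<Omega>. \<alpha> \<le> lam x \<and> Lam x \<le> \<beta> \<and>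
          (\<forall>\<xi>. lam x * (norm \<xi>)\<^sup>2 \<le> inner \<xi> (a x *v \<xi>) \<and>
               inner \<xi> (a x *v \<xi>) \<le> Lam x * (norm \<xi>)\<^sup>2)))"

section \<open>Triangulations and piecewise linear finite elements\<close>

text \<open>
  The last conjunct says that the boundary is a union of faces of the mesh. It is automatic unless
  \<open>\<Omega>\<close> has cracks, which the closure of \<open>\<Omega>\<close> does not see.
\<close>

definition mesh_of :: "(real^'d) set \<Rightarrow> (real^'d) set set \<Rightarrow> bool" where
  "mesh_of \<Omega> \<T> \<longleftrightarrow>
     triangulation \<T> \<and> (\<forall>K\<in>\<T>. int CARD('d) simplex K) \<and> \<Union>\<T> = closure \<Omega> \<and>
     frontier \<Omega> = \<Union>{F. F \<subseteq> frontier \<Omega> \<and> (\<exists>K\<in>\<T>. F face_of K)}"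

definition meshsize :: "(real^'d) set set \<Rightarrow> real" where
  "meshsize \<T> = Max (diameter ` \<T>)"

definition inradius :: "(real^'d) set \<Rightarrow> real" where
  "inradius K = Sup {r. 0 \<le> r \<and> (\<exists>x. cball x r \<subseteq> K)}"

definition shape_regular :: "real \<Rightarrow> (real^'d) set set \<Rightarrow> bool" where
  "shape_regular \<sigma> \<T> \<longleftrightarrow> (\<forall>K\<in>\<T>. diameter K \<le> \<sigma> * inradius K)"

text \<open>Only the values on the closure of \<open>\<Omega>\<close> matter.\<close>

definition P1_space :: "(real^'d) set \<Rightarrow> (real^'d) set set \<Rightarrow> (real^'d \<Rightarrow> real) set" where
  "P1_space \<Omega> \<T> = {u. continuous_on (closure \<Omega>) u \<and>
     (\<forall>K\<in>\<T>. \<exists>c g. \<forall>x\<in>K. u x = c + inner g x) \<and>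
     (\<forall>x\<in>frontier \<Omega>. u x = 0)}"

definition interior_nodes :: "(real^'d) set \<Rightarrow> (real^'d) set set \<Rightarrow> (real^'d) set" where
  "interior_nodes \<Omega> \<T> = {z \<in> \<Omega>. \<exists>K\<in>\<T>. z extreme_point_of K}"

text \<open>
  The nodal basis for an arbitrary enumeration \<open>z\<close> of the interior nodes. Elements of
  \<open>P1_space \<Omega> \<T>\<close> are determined on the closure of \<open>\<Omega>\<close> by their values at these nodes, so
  \<open>\<phi> 0, \<dots>, \<phi> (N - 1)\<close> is a basis and \<open>N\<close> is the dimension of the space.
\<close>

definition nodal_basis ::
  "(real^'d) set \<Rightarrow> (real^'d) set set \<Rightarrow> nat \<Rightarrow> (nat \<Rightarrow> real^'d \<Rightarrow> real) \<Rightarrow> bool" where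
  "nodal_basis \<Omega> \<T> N \<phi> \<longleftrightarrow>
     (\<exists>z. bij_betw z {..<N} (interior_nodes \<Omega> \<T>) \<and>
          (\<forall>i<N. \<phi> i \<in> P1_space \<Omega> \<T> \<and> (\<forall>j<N. \<phi> i (z j) = (if i = j then 1 else 0))))"

text \<open>
  For piecewise linear functions the classical gradient exists off the null set of mesh faces and
  is the weak gradient; its values on that null set do not affect the integrals below.
\<close>

definition gradient :: "(real^'d \<Rightarrow> real) \<Rightarrow> real^'d \<Rightarrow> real^'d" where
  "gradient u x = (THE g. GDERIV u x :> g)"

definition mass_matrix ::
  "(real^'d) set \<Rightarrow> nat \<Rightarrow> (nat \<Rightarrow> real^'d \<Rightarrow> real) \<Rightarrow> real mat" where
  "mass_matrix \<Omega> N \<phi> = Matrix.mat N N (\<lambda>(i, j). LINT x:\<Omega>|lebesgue. \<phi> i x * \<phi> j x)"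

definition stiffness_matrix ::
  "(real^'d) set \<Rightarrow> (real^'d \<Rightarrow> real^'d^'d) \<Rightarrow> nat \<Rightarrow> (nat \<Rightarrow> real^'d \<Rightarrow> real) \<Rightarrow> real mat" where
  "stiffness_matrix \<Omega> a N \<phi> = Matrix.mat N N (\<lambda>(i, j).
     LINT x:\<Omega>|lebesgue. inner (a x *v gradient (\<phi> i) x) (gradient (\<phi> j) x))"

section \<open>Matrices\<close>

definition lumped :: "real mat \<Rightarrow> real mat" where
  "lumped M = mat_diag (dim_row M) (\<lambda>i. \<Sum>j<dim_col M. M $$ (i, j))"

text \<open>The inverse of an invertible matrix, and an unspecified matrix otherwise.\<close>

definition minv :: "real mat \<Rightarrow> real mat" where
  "minv A = the (mat_inverse A)"

definition spec_rad :: "real mat \<Rightarrow> real" where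
  "spec_rad A = spectral_radius (map_mat complex_of_real A)"

section \<open>GMRes\<close>

definition norm2 :: "real Matrix.vec \<Rightarrow> real" where
  "norm2 v = sqrt (v \<bullet> v)"

definition poly_mat :: "real poly \<Rightarrow> real mat \<Rightarrow> real mat" where
  "poly_mat p R = Matrix.mat (dim_row R) (dim_row R)
     (\<lambda>(i, j). \<Sum>l\<le>degree p. coeff p l * (R ^\<^sub>m l) $$ (i, j))"

definition gmres_iterates :: "real mat \<Rightarrow> real Matrix.vec \<Rightarrow> (nat \<Rightarrow> real Matrix.vec) \<Rightarrow> bool" where
  "gmres_iterates R f v \<longleftrightarrow>
     (\<forall>k. v k \<in> carrier_vec (dim_col R)) \<and>
     (\<forall>k. let r = (\<lambda>k. f - R *\<^sub>v v k);
              S = {norm2 (poly_mat p R *\<^sub>v r 0) | p. degree p \<le> k \<and> poly p 0 = 1}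
          in norm2 (r k) \<in> S \<and> (\<forall>s\<in>S. norm2 (r k) \<le> s))"

text \<open>The constant may depend on the system matrix, but not on right-hand side, start or step.\<close>

definition gmres_rate_bounded_by :: "real mat \<Rightarrow> real \<Rightarrow> bool" where
  "gmres_rate_bounded_by R \<theta> \<longleftrightarrow>
     (\<exists>c. \<forall>f\<in>carrier_vec (dim_row R). \<forall>v. gmres_iterates R f v \<longrightarrow>
        (\<forall>k. norm2 (f - R *\<^sub>v v k) \<le> c * \<theta> ^ k * norm2 (f - R *\<^sub>v v 0)))"

end

theory Submission
  imports Defs
begin

text \<open>
  Let \<open>\<A>\<close> and \<open>\<B>\<close> be the system matrix and the preconditioner. With \<open>D = lumped M - M\<close>, the only
  nonzero block of \<open>E = \<B> - \<A>\<close> is \<open>D\<close>, at the lower left. If \<open>\<B> (x, y) = c E (x, y)\<close> over the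
  complex numbers, then \<open>\<tau> A x + M y = 0\<close>, and testing the second row with \<open>y\<close> gives
  \<open>\<tau> (x\<^sup>*A x + y\<^sup>*B y) = (1 - c) y\<^sup>*D x\<close>. For \<open>u = \<Sum> u\<^sub>i \<phi>\<^sub>i\<close> one has
  \<open>2 u\<^sup>*D u = \<integral> \<Sum> \<phi>\<^sub>i \<phi>\<^sub>j (u\<^sub>i - u\<^sub>j)\<^sup>2 \<le> h\<^sup>2 \<integral> \<bar>\<nabla>u\<bar>\<^sup>2\<close>, so \<open>D\<close> is dominated by \<open>\<tau> A / 2\<close> and
  \<open>\<tau> B / 2\<close> as soon as \<open>\<tau>\<close> times the coercivity constants is at least \<open>h\<^sup>2\<close>. Then \<open>\<bar>c\<bar> < 3\<close> forces
  \<open>x = y = 0\<close>. Hence \<open>\<B>\<close> is invertible and all eigenvalues of the preconditioned matrix lie within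
  distance \<open>1/3\<close> of \<open>1\<close>, which is itself an eigenvalue because \<open>E\<close> is singular; so \<open>1 \<le> \<rho> \<le> 4/3\<close>.
  The GMRes residual is bounded by that of the polynomial \<open>(1 - X)\<^sup>k\<close>, which is
  \<open>O((1/2)\<^sup>k)\<close>, and \<open>1/2 \<le> \<rho>/2\<close>.
\<close>

section \<open>The lumping perturbation of a saddle point system\<close>

text \<open>Indexed by functions rather than matrices, so that matrix entries and integrals can both
  be inserted. It is conjugate-linear in the first argument and sees only indices below
  \<open>N\<close>.\<close>

definition form :: "nat \<Rightarrow> (nat \<Rightarrow> nat \<Rightarrow> real) \<Rightarrow> (nat \<Rightarrow> complex) \<Rightarrow> (nat \<Rightarrow> complex) \<Rightarrow> complex" where
  "form N S x y = (\<Sum>i<N. cnj (x i) * (\<Sum>j<N. complex_of_real (S i j) * y j))"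

definition qform :: "nat \<Rightarrow> (nat \<Rightarrow> nat \<Rightarrow> real) \<Rightarrow> (nat \<Rightarrow> real) \<Rightarrow> real" where
  "qform N S x = (\<Sum>i<N. \<Sum>j<N. x i * S i j * x j)"

definition sym_on :: "nat \<Rightarrow> (nat \<Rightarrow> nat \<Rightarrow> real) \<Rightarrow> bool" where
  "sym_on N S \<longleftrightarrow> (\<forall>i<N. \<forall>j<N. S i j = S j i)"

lemma qform_cong:
  assumes "\<And>i j. i < N \<Longrightarrow> j < N \<Longrightarrow> S i j = S' i j"
  shows "qform N S x = qform N S' x"
  unfolding qform_def using assms by (intro sum.cong) auto

lemma sym_on_cong:
  assumes "\<And>i j. i < N \<Longrightarrow> j < N \<Longrightarrow> S i j = S' i j"
  shows "sym_on N S \<longleftrightarrow> sym_on N S'"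
  unfolding sym_on_def using assms by auto

text \<open>Symmetry cancels the cross terms between real and imaginary parts. This carries the real
  hypotheses on quadratic forms over to complex eigenvectors.\<close>

lemma form_self:
  assumes "sym_on N S"
  shows "form N S x x = of_real (qform N S (\<lambda>i. Re (x i)) + qform N S (\<lambda>i. Im (x i)))"
proof (rule complex_eqI)
  show "Re (form N S x x) = Re (of_real (qform N S (\<lambda>i. Re (x i)) + qform N S (\<lambda>i. Im (x i))))"
    by (simp add: form_def qform_def sum_distrib_left sum.distrib algebra_simps)
  have "(\<Sum>i<N. \<Sum>j<N. Im (x i) * S i j * Re (x j)) = (\<Sum>j<N. \<Sum>i<N. Im (x i) * S i j * Re (x j))"
    by (rule sum.swap)
  also have "\<dots> = (\<Sum>i<N. \<Sum>j<N. Re (x i) * S i j * Im (x j))"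
    using assms by (intro sum.cong) (auto simp: sym_on_def)
  finally show "Im (form N S x x) = Im (of_real (qform N S (\<lambda>i. Re (x i)) + qform N S (\<lambda>i. Im (x i))))"
    by (simp add: form_def sum_distrib_left algebra_simps sum.distrib sum_subtractf)
qed

lemma form_commute:
  assumes "sym_on N S"
  shows "form N S y x = cnj (form N S x y)"
proof -
  have "form N S y x = (\<Sum>i<N. \<Sum>j<N. cnj (y i) * of_real (S i j) * x j)"
    by (simp add: form_def sum_distrib_left algebra_simps)
  also have "\<dots> = (\<Sum>j<N. \<Sum>i<N. cnj (y i) * of_real (S i j) * x j)"
    by (rule sum.swap)
  also have "\<dots> = cnj (form N S x y)"
    using assms by (auto simp: form_def sum_distrib_left sym_on_def algebra_simps intro!: sum.cong)
  finally show ?thesis .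
qed

lemma form_add_left: "form N S (\<lambda>i. x i + x' i) y = form N S x y + form N S x' y"
  and form_add_right: "form N S x (\<lambda>i. y i + y' i) = form N S x y + form N S x y'"
  and form_scale_left: "form N S (\<lambda>i. c * x i) y = cnj c * form N S x y"
  and form_scale_right: "form N S x (\<lambda>i. c * y i) = c * form N S x y"
  by (simp_all add: form_def sum.distrib sum_distrib_left algebra_simps)

text \<open>A rotation of \<open>x\<close> makes the mixed term real; then expand the form at \<open>e x - y\<close>.\<close>

lemma norm_form_le:
  assumes "sym_on N S" and psd: "\<And>x. 0 \<le> qform N S x"
  shows "2 * cmod (form N S y x) \<le> Re (form N S x x) + Re (form N S y y)"
proof -
  define d where "d = form N S y x"
  \<comment> \<open>The inverse phase of \<open>d\<close>. The value 1 at \<open>d = 0\<close> keeps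
    \<open>e\<close> of modulus one, where the quotient would be 0.\<close>
  define e where "e = (if d = 0 then 1 else cnj d / of_real (cmod d))"
  have sq: "cnj d * d = of_real (cmod d) * of_real (cmod d)"
    using complex_norm_square[of d] by (simp add: power2_eq_square mult.commute)
  have ed: "e * d = of_real (cmod d)"
  proof (cases "d = 0")
    case False
    then have "e * d = (cnj d * d) / of_real (cmod d)" by (simp add: e_def)
    then show ?thesis using False by (simp add: sq)
  qed simp
  have e: "cnj e * e = 1"
  proof (cases "d = 0")
    case False
    then have "cnj e * e = (cnj d * d) / (of_real (cmod d) * of_real (cmod d))" by (simp add: e_def)
    then show ?thesis using False by (simp add: sq)
  qed (simp add: e_def)
  \<comment> \<open>A name for -1 lets the scaling rules treat both summands of \<open>?z\<close>
    alike.\<close>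
  define u :: complex where "u = - 1"
  let ?z = "\<lambda>i. e * x i + u * y i"
  have xy: "form N S x y = cnj d"
    using form_commute[OF assms(1), of x y] by (simp add: d_def)
  have "form N S ?z ?z = cnj e * e * form N S x x + cnj u * u * form N S y y
      + cnj (e * d) * u + cnj u * (e * d)"
    unfolding form_add_left form_add_right form_scale_left form_scale_right xy d_def[symmetric]
    by (simp add: algebra_simps)
  then have "form N S ?z ?z = form N S x x + form N S y y - 2 * of_real (cmod d)"
    unfolding e ed by (simp add: u_def)
  moreover have "0 \<le> Re (form N S ?z ?z)"
    using psd by (simp add: form_self[OF assms(1)])
  ultimately show ?thesis
    by (simp add: d_def)
qed

text \<open>The parameter \<open>c\<close> lets one energy argument serve three times:
  \<open>c = 0\<close> for invertibility of the preconditioner, \<open>c = 1 / (1 - \<mu>)\<close>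
  for left preconditioning and \<open>c = 1 / z\<close> for right preconditioning.\<close>

lemma saddle_point_kernel:
  fixes x y :: "nat \<Rightarrow> complex"
  assumes sym: "sym_on N A" "sym_on N B" "sym_on N M" "sym_on N D"
    and D0: "\<And>x. 0 \<le> qform N D x"
    and DA: "\<And>x. qform N D x \<le> \<tau> / 2 * qform N A x"
    and DB: "\<And>x. qform N D x \<le> \<tau> / 2 * qform N B x"
    and A0: "\<And>x. qform N A x = 0 \<Longrightarrow> \<forall>i<N. x i = 0"
    and B0: "\<And>x. qform N B x = 0 \<Longrightarrow> \<forall>i<N. x i = 0"
    and \<tau>: "0 < \<tau>" and c: "cmod c < 3"
    and row1: "\<And>i. i < N \<Longrightarrow> of_real \<tau> * (\<Sum>j<N. of_real (A i j) * x j) + (\<Sum>j<N. of_real (M i j) * y j) = 0"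
    and row2: "\<And>i. i < N \<Longrightarrow> (\<Sum>j<N. of_real (M i j + D i j) * x j)
      - of_real \<tau> * (\<Sum>j<N. of_real (B i j) * y j) = c * (\<Sum>j<N. of_real (D i j) * x j)"
  shows "\<forall>i<N. x i = 0 \<and> y i = 0"
proof -
  define qa where "qa = qform N A (\<lambda>i. Re (x i)) + qform N A (\<lambda>i. Im (x i))"
  define qb where "qb = qform N B (\<lambda>i. Re (y i)) + qform N B (\<lambda>i. Im (y i))"
  define d where "d = form N D y x"
  have qA: "0 \<le> qform N A z" and qB: "0 \<le> qform N B z" for z
    using order_trans[OF D0 DA, of z] order_trans[OF D0 DB, of z] \<tau>
    by (simp_all add: zero_le_mult_iff)
  have fA: "form N A x x = of_real qa" and fB: "form N B y y = of_real qb"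
    by (simp_all add: form_self sym qa_def qb_def)
  \<comment> \<open>Testing the first row with \<open>x\<close> shows that the coupling term is
    real. It therefore equals its conjugate, which is the coupling term of the second row tested
    with \<open>y\<close>.\<close>
  have "(\<Sum>i<N. cnj (x i) * (of_real \<tau> * (\<Sum>j<N. of_real (A i j) * x j) + (\<Sum>j<N. of_real (M i j) * y j))) = 0"
    using row1 by (intro sum.neutral) auto
  then have "of_real \<tau> * form N A x x + form N M x y = 0"
    by (simp add: form_def sum.distrib sum_distrib_left algebra_simps)
  then have M1: "form N M x y = of_real (- \<tau> * qa)"
    by (simp add: fA add_eq_0_iff2)
  have M2: "form N M y x = of_real (- \<tau> * qa)"
    unfolding form_commute[OF sym(3), of y x] M1 by simp
  \<comment> \<open>Tested with \<open>y\<close>, the second row contains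
    \<open>- \<tau> * qa\<close> from the coupling and \<open>- \<tau> * qb\<close> from its
    diagonal block. The opposite signs of the two diagonal blocks thus make the energies add
    up.\<close>
  have "(\<Sum>i<N. cnj (y i) * ((\<Sum>j<N. of_real (M i j + D i j) * x j)
      - of_real \<tau> * (\<Sum>j<N. of_real (B i j) * y j))) = (\<Sum>i<N. cnj (y i) * (c * (\<Sum>j<N. of_real (D i j) * x j)))"
    using row2 by (intro sum.cong) auto
  then have "form N M y x + form N D y x - of_real \<tau> * form N B y y = c * form N D y x"
    by (simp add: form_def sum.distrib sum_distrib_left sum_subtractf algebra_simps)
  then have "of_real (\<tau> * (qa + qb)) = (1 - c) * d"
    by (simp add: M2 fB d_def algebra_simps)
  then have "cmod (of_real (\<tau> * (qa + qb))) = cmod (1 - c) * cmod d"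
    by (simp add: norm_mult)
  moreover have nonneg: "0 \<le> qa" "0 \<le> qb"
    using qA qB by (simp_all add: qa_def qb_def)
  ultimately have eq: "\<tau> * (qa + qb) = cmod (1 - c) * cmod d"
    using \<tau> by (simp add: norm_mult abs_of_nonneg del: of_real_mult of_real_add)
  \<comment> \<open>The 2 of \<open>norm_form_le\<close> and the factor \<tau>/2 in
    \<open>DA\<close> and \<open>DB\<close> give 4, to be compared with |1 - c| \<le> 1 + |c| < 4.
    This is the origin of the radius 3 for \<open>c\<close>.\<close>
  have "2 * cmod d \<le> \<tau> / 2 * qa + \<tau> / 2 * qb"
    using norm_form_le[OF sym(4) D0, of y x] DA[of "\<lambda>i. Re (x i)"] DA[of "\<lambda>i. Im (x i)"]
      DB[of "\<lambda>i. Re (y i)"] DB[of "\<lambda>i. Im (y i)"]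
    by (simp add: form_self sym d_def qa_def qb_def algebra_simps)
  then have d: "4 * cmod d \<le> \<tau> * (qa + qb)"
    by (simp add: algebra_simps)
  have c4: "cmod (1 - c) < 4"
    using norm_triangle_ineq4[of 1 c] c by simp
  with d eq have "4 * cmod d \<le> cmod (1 - c) * cmod d"
    by linarith
  with c4 have "cmod d = 0"
    using mult_strict_right_mono[OF c4, of "cmod d"] norm_ge_zero[of d] by linarith
  with eq \<tau> have "qa + qb = 0"
    by simp
  then have "qform N A (\<lambda>i. Re (x i)) = 0" "qform N A (\<lambda>i. Im (x i)) = 0"
      "qform N B (\<lambda>i. Re (y i)) = 0" "qform N B (\<lambda>i. Im (y i)) = 0"
    using qA[of "\<lambda>i. Re (x i)"] qA[of "\<lambda>i. Im (x i)"] qB[of "\<lambda>i. Re (y i)"] qB[of "\<lambda>i. Im (y i)"]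
    unfolding qa_def qb_def by linarith+
  then show ?thesis
    using A0 B0 by (auto simp: complex_eq_iff)
qed

section \<open>GMRes for a matrix with eigenvalues near 1\<close>

lemma norm2_eq_L2_set: "norm2 v = L2_set (\<lambda>i. v $ i) {..<dim_vec v}"
  by (simp add: norm2_def L2_set_def scalar_prod_def power2_eq_square atLeast0LessThan)

text \<open>A crude factor growing with the dimension suffices, since the constant in
  \<open>gmres_rate_bounded_by\<close> may depend on the matrix.\<close>

lemma norm2_mult_mat_vec_le:
  fixes P :: "real mat"
  assumes P: "P \<in> carrier_mat n n" and v: "v \<in> carrier_vec n"
    and c: "\<And>i j. i < n \<Longrightarrow> j < n \<Longrightarrow> \<bar>P $$ (i, j)\<bar> \<le> c"
  shows "norm2 (P *\<^sub>v v) \<le> (real n * (real n * c)) * norm2 v"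
proof -
  have nn: "0 \<le> norm2 v"
    by (simp add: norm2_eq_L2_set)
  have le: "\<bar>v $ j\<bar> \<le> norm2 v" if "j < n" for j
  proof -
    have "\<bar>v $ j\<bar> \<le> L2_set (\<lambda>i. \<bar>v $ i\<bar>) {..<n}"
      using that by (intro member_le_L2_set) auto
    then show ?thesis using v by (simp add: norm2_eq_L2_set L2_set_def)
  qed
  have "norm2 (P *\<^sub>v v) \<le> (\<Sum>i<n. \<bar>(P *\<^sub>v v) $ i\<bar>)"
    using P L2_set_le_sum_abs[of "\<lambda>i. (P *\<^sub>v v) $ i" "{..<n}"]
    by (simp add: norm2_eq_L2_set del: index_mult_mat_vec)
  also have "\<dots> \<le> (\<Sum>i<n. \<Sum>j<n. c * norm2 v)"
  proof (rule sum_mono)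
    fix i assume i: "i \<in> {..<n}"
    then have "(P *\<^sub>v v) $ i = (\<Sum>j<n. P $$ (i, j) * v $ j)"
      using P v by (simp add: scalar_prod_def atLeast0LessThan)
    also have "\<bar>\<dots>\<bar> \<le> (\<Sum>j<n. \<bar>P $$ (i, j) * v $ j\<bar>)"
      by (rule sum_abs)
    also have "\<dots> \<le> (\<Sum>j<n. c * norm2 v)"
    proof (rule sum_mono)
      fix j assume j: "j \<in> {..<n}"
      have "0 \<le> c" using c[of i j] i j by auto
      then show "\<bar>P $$ (i, j) * v $ j\<bar> \<le> c * norm2 v"
        using i j c le nn unfolding abs_mult by (intro mult_mono) auto
    qed
    finally show "\<bar>(P *\<^sub>v v) $ i\<bar> \<le> (\<Sum>j<n. c * norm2 v)" .
  qed
  also have "\<dots> = (real n * (real n * c)) * norm2 v"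
    by simp
  finally show ?thesis .
qed

text \<open>With a common range of summation, polynomials of different degrees can be subtracted
  coefficientwise.\<close>

lemma poly_mat_upto:
  assumes "degree p \<le> m"
  shows "poly_mat p R = Matrix.mat (dim_row R) (dim_row R) (\<lambda>(i, j). \<Sum>l\<le>m. coeff p l * (R ^\<^sub>m l) $$ (i, j))"
proof -
  have "(\<Sum>l\<le>degree p. coeff p l * q l) = (\<Sum>l\<le>m. coeff p l * q l)" for q :: "nat \<Rightarrow> real"
    using assms by (intro sum.mono_neutral_left) (auto simp: coeff_eq_0)
  then show ?thesis by (simp add: poly_mat_def)
qed

lemma poly_mat_one_minus_power:
  fixes R :: "real mat"
  assumes R: "R \<in> carrier_mat n n"
  shows "poly_mat ([:1, -1:] ^ k) R = (1\<^sub>m n - R) ^\<^sub>m k"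
proof (induction k)
  case 0
  show ?case using R by (auto simp: poly_mat_def)
next
  case (Suc k)
  define p :: "real poly" where "p = [:1, -1:] ^ k"
  have deg: "degree p \<le> k"
    unfolding p_def using degree_power_le[of "[:1, -1 :: real:]" k] by simp
  \<comment> \<open>\<open>pCons 0 p\<close> is X times \<open>p\<close>, so this is the recursion
    (1 - X) p = p - X p.\<close>
  have p': "[:1, -1:] ^ Suc k = p - pCons 0 p"
    by (simp add: p_def)
  have deg': "degree (p - pCons 0 p) \<le> Suc k"
    by (rule degree_diff_le) (use deg degree_pCons_le[of 0 p] in linarith)+
  have pc: "poly_mat p R \<in> carrier_mat n n"
    using R by (intro carrier_matI) (simp_all add: poly_mat_def)
  have Rl: "R ^\<^sub>m l \<in> carrier_mat n n" for l
    using R by (rule pow_carrier_mat)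
  have "(1\<^sub>m n - R) ^\<^sub>m Suc k = poly_mat p R * (1\<^sub>m n - R)"
    using Suc by (simp add: p_def)
  also have "\<dots> = poly_mat p R - poly_mat p R * R"
    using mult_minus_distrib_mat[OF pc one_carrier_mat R] pc by simp
  also have "\<dots> = poly_mat ([:1, -1:] ^ Suc k) R"
    unfolding p'
  proof (rule eq_matI)
    fix i j assume "i < dim_row (poly_mat (p - pCons 0 p) R)" "j < dim_col (poly_mat (p - pCons 0 p) R)"
    then have ij: "i < n" "j < n" using R by (auto simp: poly_mat_def)
    have "(poly_mat p R * R) $$ (i, j) = (\<Sum>s<n. (\<Sum>l\<le>k. coeff p l * (R ^\<^sub>m l) $$ (i, s)) * R $$ (s, j))"
      using ij R by (auto simp: scalar_prod_def poly_mat_upto[OF deg] atLeast0LessThan)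
    also have "\<dots> = (\<Sum>s<n. \<Sum>l\<le>k. coeff p l * ((R ^\<^sub>m l) $$ (i, s) * R $$ (s, j)))"
      by (simp add: sum_distrib_right mult.assoc)
    also have "\<dots> = (\<Sum>l\<le>k. \<Sum>s<n. coeff p l * ((R ^\<^sub>m l) $$ (i, s) * R $$ (s, j)))"
      by (rule sum.swap)
    also have "\<dots> = (\<Sum>l\<le>k. coeff p l * (R ^\<^sub>m Suc l) $$ (i, j))"
    proof (rule sum.cong)
      fix l
      have "(R ^\<^sub>m Suc l) $$ (i, j) = (\<Sum>s<n. (R ^\<^sub>m l) $$ (i, s) * R $$ (s, j))"
        using ij R Rl[of l] by (auto simp: scalar_prod_def atLeast0LessThan)
      then show "(\<Sum>s<n. coeff p l * ((R ^\<^sub>m l) $$ (i, s) * R $$ (s, j))) = coeff p l * (R ^\<^sub>m Suc l) $$ (i, j)"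
        by (simp add: sum_distrib_left)
    qed simp
    \<comment> \<open>The coefficients of X p are those of \<open>p\<close> shifted by one, and the
      new term at index 0 vanishes.\<close>
    also have "\<dots> = (\<Sum>l\<le>Suc k. coeff (pCons 0 p) l * (R ^\<^sub>m l) $$ (i, j))"
      by (simp only: sum.atMost_Suc_shift coeff_pCons_0 coeff_pCons_Suc mult_zero_left add_0)
    finally have R1: "(poly_mat p R * R) $$ (i, j) = \<dots>" .
    have "poly_mat p R $$ (i, j) = (\<Sum>l\<le>Suc k. coeff p l * (R ^\<^sub>m l) $$ (i, j))"
      using ij R poly_mat_upto[of p "Suc k" R] deg by (simp del: sum.atMost_Suc)
    moreover have "poly_mat (p - pCons 0 p) R $$ (i, j)
        = (\<Sum>l\<le>Suc k. coeff p l * (R ^\<^sub>m l) $$ (i, j)) - (\<Sum>l\<le>Suc k. coeff (pCons 0 p) l * (R ^\<^sub>m l) $$ (i, j))"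
      using ij R by (simp add: poly_mat_upto[OF deg'] sum_subtractf left_diff_distrib del: sum.atMost_Suc)
    moreover have "(poly_mat p R - poly_mat p R * R) $$ (i, j) = poly_mat p R $$ (i, j) - (poly_mat p R * R) $$ (i, j)"
      using ij R pc by (intro index_minus_mat) auto
    ultimately show "(poly_mat p R - poly_mat p R * R) $$ (i, j) = poly_mat (p - pCons 0 p) R $$ (i, j)"
      by (simp only: R1)
  qed (use R in \<open>auto simp: poly_mat_def\<close>)
  finally show ?case by simp
qed

section \<open>Complex matrices: powers, eigenvalues and the residual bound\<close>

abbreviation cmat :: "real mat \<Rightarrow> complex mat" where
  "cmat \<equiv> map_mat complex_of_real"

lemma cmat_pow:
  assumes "A \<in> carrier_mat n n"
  shows "cmat (A ^\<^sub>m k) = cmat A ^\<^sub>m k"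
proof (induction k)
  case (Suc k)
  have "cmat (A ^\<^sub>m k * A) = cmat (A ^\<^sub>m k) * cmat A"
    by (rule of_real_hom.mat_hom_mult[OF pow_carrier_mat[OF assms] assms])
  then show ?case
    using Suc by simp
qed (use assms in \<open>simp add: of_real_hom.mat_hom_one\<close>)

lemma eigenvalue_iff:
  assumes "A \<in> carrier_mat n n"
  shows "eigenvalue A k \<longleftrightarrow> (\<exists>v \<in> carrier_vec n. v \<noteq> 0\<^sub>v n \<and> A *\<^sub>v v = k \<cdot>\<^sub>v v)"
  unfolding eigenvalue_def eigenvector_def carrier_matD(1)[OF assms] by blast

lemma smult_pow_mat:
  fixes A :: "'a :: field mat"
  assumes A: "A \<in> carrier_mat n n"
  shows "(c \<cdot>\<^sub>m A) ^\<^sub>m k = c ^ k \<cdot>\<^sub>m A ^\<^sub>m k"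
proof (induction k)
  case (Suc k)
  have Ak: "A ^\<^sub>m k \<in> carrier_mat n n"
    using A by (rule pow_carrier_mat)
  have "(c \<cdot>\<^sub>m A) ^\<^sub>m Suc k = (c ^ k \<cdot>\<^sub>m A ^\<^sub>m k) * (c \<cdot>\<^sub>m A)"
    using Suc by simp
  also have "\<dots> = c ^ k \<cdot>\<^sub>m (c \<cdot>\<^sub>m (A ^\<^sub>m k * A))"
    using mult_smult_distrib[OF Ak A, of c] mult_smult_assoc_mat[OF Ak smult_carrier_mat[OF A], of "c ^ k" c]
    by simp
  also have "\<dots> = c ^ Suc k \<cdot>\<^sub>m A ^\<^sub>m Suc k"
    by (rule eq_matI) (simp_all add: mult.assoc mult.left_commute)
  finally show ?case .
qed (use A in auto)

text \<open>The matrix \<open>2 (1 - R)\<close> has spectral radius below 1, hence bounded powers.\<close>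

lemma gmres_rate_of_eigenvalues:
  assumes R: "R \<in> carrier_mat n n" and n: "0 < n"
    and ev: "\<And>z. eigenvalue (cmat (1\<^sub>m n - R)) z \<Longrightarrow> cmod z < 1 / 2"
    and \<theta>: "1 / 2 \<le> \<theta>"
  shows "gmres_rate_bounded_by R \<theta>"
proof -
  define G where "G = 1\<^sub>m n - R"
  have G: "G \<in> carrier_mat n n"
    using R by (simp add: G_def minus_carrier_mat)
  have Gk: "G ^\<^sub>m k \<in> carrier_mat n n" for k
    using G by (rule pow_carrier_mat)
  define T where "T = cmat (2 \<cdot>\<^sub>m G)"
  have T: "T \<in> carrier_mat n n"
    using G by (simp add: T_def)
  have "cmod z < 1" if eig: "eigenvalue T z" for z
  proof -
    obtain v where v: "v \<in> carrier_vec n" "v \<noteq> 0\<^sub>v n" "T *\<^sub>v v = z \<cdot>\<^sub>v v"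
      using eig unfolding eigenvalue_iff[OF T] by blast
    have "cmat G *\<^sub>v v = (z / 2) \<cdot>\<^sub>v v"
    proof (rule eq_vecI)
      fix i assume "i < dim_vec ((z / 2) \<cdot>\<^sub>v v)"
      then have i: "i < n" using v by simp
      have "(T *\<^sub>v v) $ i = (z \<cdot>\<^sub>v v) $ i"
        by (simp only: v(3))
      then have "2 * (cmat G *\<^sub>v v) $ i = z * v $ i"
        using i G v(1) by (simp add: T_def scalar_prod_def sum_distrib_left mult.assoc)
      then show "(cmat G *\<^sub>v v) $ i = ((z / 2) \<cdot>\<^sub>v v) $ i"
        using i v(1) by (simp add: field_simps del: index_mult_mat_vec)
    qed (use G v(1) in simp)
    then have "eigenvalue (cmat G) (z / 2)"
      using v G by (subst eigenvalue_iff[of _ n]) auto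
    from ev[OF this[unfolded G_def]] show ?thesis
      by (simp add: norm_divide)
  qed
  \<comment> \<open>The spectral radius is attained at an eigenvalue because \<open>n\<close> is
    positive, so the strict bound passes to it.\<close>
  moreover have "spectral_radius T \<in> cmod ` spectrum T"
    using spectral_radius_mem_max(1)[OF T n] .
  ultimately have "spectral_radius T < 1"
    by (auto simp: spectrum_def)
  \<comment> \<open>Strictness matters: at spectral radius 1, Jordan blocks could let the powers
    grow.\<close>
  from spectral_radius_jnf_norm_bound_less_1_upper_triangular[OF T this]
  obtain c where c: "\<And>k. norm_bound (T ^\<^sub>m k) c"
    by blast
  \<comment> \<open>Undoing the scaling by 2 turns bounded powers of \<open>T\<close> into geometric
    decay of those of \<open>G\<close>.\<close>
  have bound: "\<bar>(G ^\<^sub>m k) $$ (i, j)\<bar> \<le> c * (1 / 2) ^ k" if "i < n" "j < n" for i j k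
  proof -
    have "T ^\<^sub>m k = cmat (2 ^ k \<cdot>\<^sub>m G ^\<^sub>m k)"
      using G by (simp add: T_def smult_pow_mat flip: cmat_pow[of "2 \<cdot>\<^sub>m G" n])
    then have "cmod ((T ^\<^sub>m k) $$ (i, j)) = 2 ^ k * \<bar>(G ^\<^sub>m k) $$ (i, j)\<bar>"
      using that carrier_matD[OF Gk[of k]] by (simp add: norm_mult norm_power)
    moreover have "cmod ((T ^\<^sub>m k) $$ (i, j)) \<le> c"
      using c[of k] that unfolding norm_bound_def carrier_matD[OF pow_carrier_mat[OF T, of k]] by blast
    ultimately show ?thesis
      by (simp add: field_simps)
  qed
  have c0: "0 \<le> c"
    using bound[OF n n, of 0] by simp
  show ?thesis
    unfolding gmres_rate_bounded_by_def
  proof (intro exI[of _ "real n * (real n * c)"] ballI allI impI)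
    fix f v k
    assume f: "f \<in> carrier_vec (dim_row R)" and v: "gmres_iterates R f v"
    define r where "r = (\<lambda>k. f - R *\<^sub>v v k)"
    have r0: "r 0 \<in> carrier_vec n"
      using R f v by (auto simp: r_def gmres_iterates_def)
    \<comment> \<open>The polynomial (1 - X)^k is admissible in the minimum that defines the
      residual at step \<open>k\<close>.\<close>
    have "degree ([:1, -1 :: real:] ^ k) \<le> k"
      using degree_power_le[of "[:1, -1 :: real:]" k] by simp
    moreover have "poly ([:1, -1 :: real:] ^ k) 0 = 1"
      by simp
    ultimately have "norm2 (poly_mat ([:1, -1:] ^ k) R *\<^sub>v r 0)
        \<in> {norm2 (poly_mat p R *\<^sub>v r 0) | p. degree p \<le> k \<and> poly p 0 = 1}"
      by blast
    then have "norm2 (r k) \<le> norm2 (poly_mat ([:1, -1:] ^ k) R *\<^sub>v r 0)"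
      using v by (auto simp: gmres_iterates_def Let_def r_def)
    also have "\<dots> = norm2 (G ^\<^sub>m k *\<^sub>v r 0)"
      by (simp add: poly_mat_one_minus_power[OF R] G_def)
    also have "\<dots> \<le> real n * (real n * (c * (1 / 2) ^ k)) * norm2 (r 0)"
      by (rule norm2_mult_mat_vec_le[OF Gk r0 bound])
    also have "\<dots> = real n * (real n * c) * (1 / 2) ^ k * norm2 (r 0)"
      by simp
    also have "\<dots> \<le> real n * (real n * c) * \<theta> ^ k * norm2 (r 0)"
      using \<theta> c0 by (intro mult_right_mono mult_left_mono power_mono)
        (auto simp: norm2_eq_L2_set)
    finally show "norm2 (f - R *\<^sub>v v k) \<le> real n * (real n * c) * \<theta> ^ k * norm2 (f - R *\<^sub>v v 0)"
      by (simp add: r_def)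
  qed
qed

section \<open>The lumped preconditioner\<close>

text \<open>Turns a block system into the two scalar row equations of
  \<open>saddle_point_kernel\<close>; the second block of unknowns is stored from index
  \<open>N\<close> on.\<close>

lemma four_block_mat_mult_vec_index:
  fixes p :: "complex Matrix.vec"
  assumes "A \<in> carrier_mat N N" "B \<in> carrier_mat N N" "C \<in> carrier_mat N N" "D \<in> carrier_mat N N"
    and p: "p \<in> carrier_vec (N + N)" and i: "i < N"
  shows "(cmat (four_block_mat A B C D) *\<^sub>v p) $ i
      = (\<Sum>j<N. of_real (A $$ (i, j)) * p $ j) + (\<Sum>j<N. of_real (B $$ (i, j)) * p $ (N + j))"
    and "(cmat (four_block_mat A B C D) *\<^sub>v p) $ (N + i)
      = (\<Sum>j<N. of_real (C $$ (i, j)) * p $ j) + (\<Sum>j<N. of_real (D $$ (i, j)) * p $ (N + j))"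
proof -
  have split: "(\<Sum>j = 0..<N + N. g j) = (\<Sum>j<N. g j) + (\<Sum>j<N. g (N + j))" for g :: "nat \<Rightarrow> complex"
    using sum.atLeastLessThan_concat[of 0 N "N + N" g] sum.shift_bounds_nat_ivl[of g 0 N N]
    by (simp add: atLeast0LessThan add.commute)
  show "(cmat (four_block_mat A B C D) *\<^sub>v p) $ i
      = (\<Sum>j<N. of_real (A $$ (i, j)) * p $ j) + (\<Sum>j<N. of_real (B $$ (i, j)) * p $ (N + j))"
    using assms by (simp add: scalar_prod_def split)
  show "(cmat (four_block_mat A B C D) *\<^sub>v p) $ (N + i)
      = (\<Sum>j<N. of_real (C $$ (i, j)) * p $ j) + (\<Sum>j<N. of_real (D $$ (i, j)) * p $ (N + j))"
    using assms by (simp add: scalar_prod_def split)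
qed

definition entries :: "real mat \<Rightarrow> nat \<Rightarrow> nat \<Rightarrow> real" where
  "entries A i j = A $$ (i, j)"

text \<open>Pure linear algebra: the assumptions collect what the finite element matrices have to
  supply, with \<open>L\<close> in the role of the lumped mass matrix.\<close>

lemma lumped_preconditioner:
  fixes A B M L :: "real mat" and \<tau> :: real
  defines "\<A> \<equiv> four_block_mat (\<tau> \<cdot>\<^sub>m A) M M (- (\<tau> \<cdot>\<^sub>m B))"
    and "\<B> \<equiv> four_block_mat (\<tau> \<cdot>\<^sub>m A) M L (- (\<tau> \<cdot>\<^sub>m B))"
  assumes carrier: "A \<in> carrier_mat N N" "B \<in> carrier_mat N N" "M \<in> carrier_mat N N" "L \<in> carrier_mat N N"
    and N: "0 < N"
    and sym: "sym_on N (entries A)" "sym_on N (entries B)" "sym_on N (entries M)" "sym_on N (entries (L - M))"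
    and D0: "\<And>x. 0 \<le> qform N (entries (L - M)) x"
    and DA: "\<And>x. qform N (entries (L - M)) x \<le> \<tau> / 2 * qform N (entries A) x"
    and DB: "\<And>x. qform N (entries (L - M)) x \<le> \<tau> / 2 * qform N (entries B) x"
    and A0: "\<And>x. qform N (entries A) x = 0 \<Longrightarrow> \<forall>i<N. x i = 0"
    and B0: "\<And>x. qform N (entries B) x = 0 \<Longrightarrow> \<forall>i<N. x i = 0"
    and \<tau>: "0 < \<tau>"
  shows "invertible_mat \<B>"
    and "spec_rad (minv \<B> * \<A>) < 2"
    and "gmres_rate_bounded_by (\<A> * minv \<B>) (spec_rad (minv \<B> * \<A>) / 2)"
proof -
  define E where "E = four_block_mat (0\<^sub>m N N) (0\<^sub>m N N) (L - M) (0\<^sub>m N N)"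
  let ?n = "N + N"
  have cA: "\<A> \<in> carrier_mat ?n ?n" and cB: "\<B> \<in> carrier_mat ?n ?n" and cE: "E \<in> carrier_mat ?n ?n"
    using carrier unfolding \<A>_def \<B>_def E_def by (auto intro!: four_block_carrier_mat)
  have \<A>: "\<A> = \<B> - E"
    using carrier by (intro eq_matI) (auto simp: \<A>_def \<B>_def E_def)
  have kernel: "p = 0\<^sub>v ?n"
    if p: "p \<in> carrier_vec ?n" and c: "cmod c < 3" and eq: "cmat \<B> *\<^sub>v p = c \<cdot>\<^sub>v (cmat E *\<^sub>v p)" for p c
  proof -
    have ind: "(cmat \<B> *\<^sub>v p) $ i = c * (cmat E *\<^sub>v p) $ i" if "i < ?n" for i
      using that cE p unfolding eq by simp
    have "\<forall>i<N. p $ i = 0 \<and> p $ (N + i) = 0"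
    proof (rule saddle_point_kernel[of N "entries A" "entries B" "entries M" "entries (L - M)" \<tau> c])
      fix i assume i: "i < N"
      have car: "\<tau> \<cdot>\<^sub>m A \<in> carrier_mat N N" "- (\<tau> \<cdot>\<^sub>m B) \<in> carrier_mat N N" "L - M \<in> carrier_mat N N"
        using carrier by auto
      note rowB = four_block_mat_mult_vec_index[OF car(1) carrier(3,4) car(2) p i, folded \<B>_def]
      note rowE = four_block_mat_mult_vec_index[OF zero_carrier_mat zero_carrier_mat car(3) zero_carrier_mat p i, folded E_def]
      show "of_real \<tau> * (\<Sum>j<N. of_real (entries A i j) * p $ j) + (\<Sum>j<N. of_real (entries M i j) * p $ (N + j)) = 0"
        using ind[of i] i carrier unfolding rowB rowE
        by (simp add: entries_def sum_distrib_left mult.assoc)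
      show "(\<Sum>j<N. of_real (entries M i j + entries (L - M) i j) * p $ j)
          - of_real \<tau> * (\<Sum>j<N. of_real (entries B i j) * p $ (N + j))
          = c * (\<Sum>j<N. of_real (entries (L - M) i j) * p $ j)"
        using ind[of "N + i"] i carrier unfolding rowB rowE
        by (simp add: entries_def sum_distrib_left sum_negf mult.assoc)
    qed (use sym D0 DA DB A0 B0 \<tau> c in auto)
    then show ?thesis
    proof (intro eq_vecI)
      fix i assume *: "\<forall>i<N. p $ i = 0 \<and> p $ (N + i) = 0" and "i < dim_vec (0\<^sub>v ?n)"
      then show "p $ i = 0\<^sub>v ?n $ i"
        by (cases "i < N") (auto dest: spec[of _ "i - N"])
    qed (use p in auto)
  qed
  \<comment> \<open>A real null vector, made complex, solves the equation of \<open>kernel\<close>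
    with \<open>c = 0\<close>.\<close>
  have "det \<B> \<noteq> 0"
  proof
    assume "det \<B> = 0"
    then obtain v where v: "v \<in> carrier_vec ?n" "v \<noteq> 0\<^sub>v ?n" "\<B> *\<^sub>v v = 0\<^sub>v ?n"
      using det_0_iff_vec_prod_zero_field[OF cB] by blast
    define p where "p = map_vec complex_of_real v"
    have p: "p \<in> carrier_vec ?n"
      using v by (simp add: p_def)
    have "cmat \<B> *\<^sub>v p = map_vec complex_of_real (\<B> *\<^sub>v v)"
      unfolding p_def by (rule of_real_hom.mult_mat_vec_hom[OF cB v(1), symmetric])
    also have "\<dots> = 0 \<cdot>\<^sub>v (cmat E *\<^sub>v p)"
      unfolding v(3) using cE by (intro eq_vecI) auto
    finally have p0: "p = 0\<^sub>v ?n"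
      by (intro kernel[OF p, of 0]) auto
    have "v = 0\<^sub>v ?n"
    proof (rule eq_vecI)
      fix i assume "i < dim_vec (0\<^sub>v ?n :: real Matrix.vec)"
      then have i: "i < ?n" by simp
      then have "p $ i = of_real (v $ i)"
        using v(1) by (simp add: p_def)
      then show "v $ i = 0\<^sub>v ?n $ i"
        using i p0 by simp
    qed (use v in simp)
    then show False using v by blast
  qed
  \<comment> \<open>Invertibility passes through the units of the matrix ring; \<open>()\<close>
    fills the extension slot of the ring record.\<close>
  then obtain P where "mat_inverse \<B> = Some P"
    using mat_inverse(1)[OF cB, of "()"] det_non_zero_imp_unit[OF cB, of "()"] by blast
  then have minv: "minv \<B> = P" and P: "P \<in> carrier_mat ?n ?n" "\<B> * P = 1\<^sub>m ?n" "P * \<B> = 1\<^sub>m ?n"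
    using mat_inverse(2)[OF cB] by (auto simp: minv_def)
  show "invertible_mat \<B>"
    unfolding invertible_mat_def inverts_mat_def using P cB by auto
  have hom: "cmat (X * Y) = cmat X * cmat Y" if "X \<in> carrier_mat ?n ?n" "Y \<in> carrier_mat ?n ?n" for X Y
    using of_real_hom.mat_hom_mult[OF that] .
  have cP: "cmat P \<in> carrier_mat ?n ?n" and cB': "cmat \<B> \<in> carrier_mat ?n ?n"
    and cA': "cmat \<A> \<in> carrier_mat ?n ?n" and cE': "cmat E \<in> carrier_mat ?n ?n"
    using P cB cA cE by auto
  have BP: "cmat \<B> * cmat P = 1\<^sub>m ?n" and PB: "cmat P * cmat \<B> = 1\<^sub>m ?n"
    using hom[OF cB P(1)] hom[OF P(1) cB] P by (simp_all add: of_real_hom.mat_hom_one)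
  have A': "cmat \<A> *\<^sub>v v = cmat \<B> *\<^sub>v v - cmat E *\<^sub>v v" if "v \<in> carrier_vec ?n" for v
  proof -
    have "cmat \<A> = cmat \<B> - cmat E"
      unfolding \<A> using cB cE by (intro eq_matI) auto
    then show ?thesis
      using minus_mult_distrib_mat_vec[OF cB' cE' that] by simp
  qed
  have PA: "cmat (P * \<A>) \<in> carrier_mat ?n ?n" and EP: "cmat (E * P) \<in> carrier_mat ?n ?n"
    using P cA cE by simp_all
  \<comment> \<open>An eigenvector \<open>v\<close> for \<mu> satisfies (1 - \<mu>)
    \<open>\<B>\<close> v = \<open>E\<close> v, so \<open>kernel\<close> applies with
    \<open>c = 1 / (1 - \<mu>)\<close>, whose modulus is below 3 once |1 - \<mu>| exceeds
    1/3.\<close>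
  have ev_bound: "cmod (1 - \<mu>) \<le> 1 / 3" if eig: "eigenvalue (cmat (P * \<A>)) \<mu>" for \<mu>
  proof (rule ccontr)
    assume big: "\<not> cmod (1 - \<mu>) \<le> 1 / 3"
    then have nz: "1 - \<mu> \<noteq> 0" by auto
    obtain v where v: "v \<in> carrier_vec ?n" "v \<noteq> 0\<^sub>v ?n" "cmat (P * \<A>) *\<^sub>v v = \<mu> \<cdot>\<^sub>v v"
      using eig unfolding eigenvalue_iff[OF PA] by blast
    have "cmat P *\<^sub>v (cmat \<A> *\<^sub>v v) = \<mu> \<cdot>\<^sub>v v"
      using v assoc_mult_mat_vec[OF cP cA' v(1)] hom[OF P(1) cA] by simp
    then have "cmat \<B> *\<^sub>v (cmat P *\<^sub>v (cmat \<A> *\<^sub>v v)) = \<mu> \<cdot>\<^sub>v (cmat \<B> *\<^sub>v v)"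
      using mult_mat_vec[OF cB' v(1)] by simp
    then have Av: "cmat \<A> *\<^sub>v v = \<mu> \<cdot>\<^sub>v (cmat \<B> *\<^sub>v v)"
      using assoc_mult_mat_vec[OF cB' cP mult_mat_vec_carrier[OF cA' v(1)]] BP
        one_mult_mat_vec[OF mult_mat_vec_carrier[OF cA' v(1)]] by simp
    have "cmat \<B> *\<^sub>v v = (1 / (1 - \<mu>)) \<cdot>\<^sub>v (cmat E *\<^sub>v v)"
    proof (rule eq_vecI)
      fix i assume "i < dim_vec ((1 / (1 - \<mu>)) \<cdot>\<^sub>v (cmat E *\<^sub>v v))"
      then have i: "i < ?n" using cE by simp
      have "(cmat \<B> *\<^sub>v v - cmat E *\<^sub>v v) $ i = (\<mu> \<cdot>\<^sub>v (cmat \<B> *\<^sub>v v)) $ i"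
        using Av A'[OF v(1)] by simp
      then have "(cmat \<B> *\<^sub>v v) $ i - (cmat E *\<^sub>v v) $ i = \<mu> * (cmat \<B> *\<^sub>v v) $ i"
        using i cE cB by (simp del: index_mult_mat_vec)
      then have "(1 - \<mu>) * (cmat \<B> *\<^sub>v v) $ i = (cmat E *\<^sub>v v) $ i"
        by (simp add: algebra_simps del: index_mult_mat_vec)
      then show "(cmat \<B> *\<^sub>v v) $ i = ((1 / (1 - \<mu>)) \<cdot>\<^sub>v (cmat E *\<^sub>v v)) $ i"
        using nz i cE by (simp add: field_simps del: index_mult_mat_vec)
    qed (use cB cE in simp)
    moreover have "cmod (1 / (1 - \<mu>)) < 3"
      using big nz by (simp add: norm_divide field_simps)
    ultimately show False
      using kernel[OF v(1)] v(2) by blast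
  qed
  have sr: "spec_rad (P * \<A>) \<in> cmod ` spectrum (cmat (P * \<A>))"
    unfolding spec_rad_def using spectral_radius_mem_max(1)[OF PA] N by simp
  then obtain \<mu> where \<mu>: "spec_rad (P * \<A>) = cmod \<mu>" "eigenvalue (cmat (P * \<A>)) \<mu>"
    by (auto simp: spectrum_def)
  have "cmod \<mu> \<le> 1 + cmod (1 - \<mu>)"
    using norm_triangle_ineq4[of 1 "1 - \<mu>"] by simp
  then show "spec_rad (minv \<B> * \<A>) < 2"
    using ev_bound[OF \<mu>(2)] \<mu>(1) minv by simp
  have "eigenvalue (cmat (P * \<A>)) 1"
  proof -
    \<comment> \<open>Counting from 0, this is the first unit vector of the second block.
      \<open>E\<close> reads only the first block, so \<open>\<A>\<close> and \<open>\<B>\<close>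
      agree on it.\<close>
    define v :: "complex Matrix.vec" where "v = unit_vec ?n N"
    have v: "v \<in> carrier_vec ?n" "v \<noteq> 0\<^sub>v ?n"
      using N by (auto simp: v_def)
    have vj: "v $ j = 0" if "j < N" for j
      using that by (simp add: v_def)
    have "cmat E *\<^sub>v v = 0\<^sub>v ?n"
    proof (rule eq_vecI)
      fix i assume "i < dim_vec (0\<^sub>v ?n :: complex Matrix.vec)"
      then consider "i < N" | k where "i = N + k" "k < N"
        by (metis index_zero_vec(2) le_add_diff_inverse nat_add_left_cancel_less not_le)
      then show "(cmat E *\<^sub>v v) $ i = 0\<^sub>v ?n $ i"
        using four_block_mat_mult_vec_index[OF zero_carrier_mat zero_carrier_mat minus_carrier_mat[OF carrier(3)]
            zero_carrier_mat v(1), of _ L, folded E_def] vj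
        by cases (simp_all del: index_mult_mat_vec)
    qed (use cE in simp)
    then have "cmat \<A> *\<^sub>v v = cmat \<B> *\<^sub>v v"
      using A'[OF v(1)] cB' v(1) by (intro eq_vecI) auto
    then have "cmat (P * \<A>) *\<^sub>v v = cmat P *\<^sub>v (cmat \<B> *\<^sub>v v)"
      using hom[OF P(1) cA] assoc_mult_mat_vec[OF cP cA' v(1)] by simp
    also have "\<dots> = 1 \<cdot>\<^sub>v v"
      using assoc_mult_mat_vec[OF cP cB' v(1)] PB v by simp
    finally show ?thesis
      unfolding eigenvalue_iff[OF PA] using v by blast
  qed
  then have "1 \<in> cmod ` spectrum (cmat (P * \<A>))"
    by (force simp: spectrum_def)
  then have ge1: "1 \<le> spec_rad (P * \<A>)"
    unfolding spec_rad_def using spectral_radius_mem_max(2)[OF PA] N by simp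
  \<comment> \<open>GMRes has the preconditioner on the right, so its error matrix is
    \<open>E * P\<close> and not \<open>P * E\<close>.\<close>
  have "1\<^sub>m ?n - \<A> * P = E * P"
  proof -
    have "\<A> * P = 1\<^sub>m ?n - E * P"
      unfolding \<A> using minus_mult_distrib_mat[OF cB cE P(1)] P by simp
    then show ?thesis
      using cE P(1) by (intro eq_matI) auto
  qed
  \<comment> \<open>The bound 1/2 is chosen because \<open>ge1\<close> makes it at most half the
    spectral radius. For an eigenvector \<open>w\<close>, the vector \<open>P w\<close> solves the
    equation of \<open>kernel\<close> with \<open>c = 1 / z\<close>, of modulus at most 2 if the
    bound fails.\<close>
  moreover have "cmod z < 1 / 2" if eig: "eigenvalue (cmat (E * P)) z" for z
  proof (rule ccontr)
    assume big: "\<not> cmod z < 1 / 2"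
    then have nz: "z \<noteq> 0" by auto
    obtain w where w: "w \<in> carrier_vec ?n" "w \<noteq> 0\<^sub>v ?n" "cmat (E * P) *\<^sub>v w = z \<cdot>\<^sub>v w"
      using eig unfolding eigenvalue_iff[OF EP] by blast
    define v where "v = cmat P *\<^sub>v w"
    have v: "v \<in> carrier_vec ?n"
      using cP w by (simp add: v_def)
    have Bv: "cmat \<B> *\<^sub>v v = w"
      unfolding v_def using assoc_mult_mat_vec[OF cB' cP w(1)] BP w(1) by simp
    have "cmat E *\<^sub>v v = z \<cdot>\<^sub>v w"
      unfolding v_def using assoc_mult_mat_vec[OF cE' cP w(1)] hom[OF cE P(1)] w(3) by simp
    then have "cmat \<B> *\<^sub>v v = (1 / z) \<cdot>\<^sub>v (cmat E *\<^sub>v v)"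
      using nz Bv w(1) by (simp add: smult_smult_assoc)
    moreover have "cmod (1 / z) < 3"
      using big nz by (simp add: norm_divide field_simps)
    ultimately have "v = 0\<^sub>v ?n"
      using kernel[OF v] by blast
    then have "w = 0\<^sub>v ?n"
      using Bv cB' by (auto intro!: eq_vecI)
    with w show False by blast
  qed
  ultimately show "gmres_rate_bounded_by (\<A> * minv \<B>) (spec_rad (minv \<B> * \<A>) / 2)"
    unfolding minv using ge1 P(1) cA N by (intro gmres_rate_of_eigenvalues[where n = ?n]) auto
qed

section \<open>Linear finite elements\<close>

lemma gradient_affine:
  fixes f :: "real^'d \<Rightarrow> real"
  assumes x: "x \<in> interior K" and f: "\<And>y. y \<in> K \<Longrightarrow> f y = c + inner g y"
  shows "gradient f x = g"
proof -
  have "((\<lambda>y. c + inner g y) has_derivative (\<lambda>h. inner h g)) (at x)"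
    by (auto intro!: derivative_eq_intros simp: inner_commute)
  then have "(f has_derivative (\<lambda>h. inner h g)) (at x)"
    by (rule has_derivative_transform_within_open[OF _ open_interior x])
      (use f interior_subset in force)
  then have "GDERIV f x :> g"
    by (simp add: gderiv_def)
  \<comment> \<open>\<open>gradient\<close> is a definite description, so uniqueness has to be shown
    as well.\<close>
  moreover have "g' = g" if "GDERIV f x :> g'" for g'
  proof -
    have "(\<lambda>h. inner h g') = (\<lambda>h. inner h g)"
      using that \<open>GDERIV f x :> g\<close> unfolding gderiv_def by (rule has_derivative_unique)
    then have "inner (g' - g) (g' - g) = 0"
      by (metis cancel_comm_monoid_add_class.diff_cancel inner_diff_right)
    then show ?thesis by simp
  qed
  ultimately show ?thesis
    unfolding gradient_def by (rule the_equality)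
qed

lemma diffusion_coefficient_bounds:
  fixes a :: "real^'d \<Rightarrow> real^'d^'d"
  assumes "diffusion_coefficient \<Omega> a"
  obtains \<alpha> \<beta> where "0 < \<alpha>"
    "\<And>x \<xi>. x \<in> \<Omega> \<Longrightarrow> \<alpha> * (norm \<xi>)\<^sup>2 \<le> inner \<xi> (a x *v \<xi>)"
    "\<And>x \<xi>. x \<in> \<Omega> \<Longrightarrow> inner \<xi> (a x *v \<xi>) \<le> \<beta> * (norm \<xi>)\<^sup>2"
proof -
  obtain lam Lam :: "real^'d \<Rightarrow> real" and \<alpha> \<beta> where \<alpha>: "0 < \<alpha>"
    and *: "\<forall>x\<in>\<Omega>. \<alpha> \<le> lam x \<and> Lam x \<le> \<beta> \<and>
          (\<forall>\<xi>. lam x * (norm \<xi>)\<^sup>2 \<le> inner \<xi> (a x *v \<xi>) \<and>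
               inner \<xi> (a x *v \<xi>) \<le> Lam x * (norm \<xi>)\<^sup>2)"
    using assms unfolding diffusion_coefficient_def by blast
  show thesis
  proof
    fix x \<xi> :: "real^'d" assume x: "x \<in> \<Omega>"
    have "\<alpha> * (norm \<xi>)\<^sup>2 \<le> lam x * (norm \<xi>)\<^sup>2" "Lam x * (norm \<xi>)\<^sup>2 \<le> \<beta> * (norm \<xi>)\<^sup>2"
      using * x by (auto intro!: mult_right_mono)
    then show "\<alpha> * (norm \<xi>)\<^sup>2 \<le> inner \<xi> (a x *v \<xi>)" "inner \<xi> (a x *v \<xi>) \<le> \<beta> * (norm \<xi>)\<^sup>2"
      using * x by (auto intro: order_trans)
  qed (rule \<alpha>)
qed

lemma inner_matrix_sym:
  fixes A :: "real^'d^'d"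
  assumes "transpose A = A"
  shows "inner (A *v v) w = inner v (A *v w)"
  by (metis assms dot_lmul_matrix transpose_matrix_vector)

text \<open>Polarization: positivity of the form at \<open>v + w\<close> and \<open>v - w\<close>
  bounds the mixed term by the diagonal ones. No separate bound on the matrix entries is required
  for integrability.\<close>

lemma inner_matrix_bound:
  fixes A :: "real^'d^'d"
  assumes sym: "transpose A = A"
    and pos: "\<And>\<xi>. 0 \<le> inner \<xi> (A *v \<xi>)" and le: "\<And>\<xi>. inner \<xi> (A *v \<xi>) \<le> \<beta> * (norm \<xi>)\<^sup>2"
  shows "2 * \<bar>inner (A *v v) w\<bar> \<le> \<beta> * (norm v)\<^sup>2 + \<beta> * (norm w)\<^sup>2"
proof -
  have "inner (v + w) (A *v (v + w)) = inner v (A *v v) + inner w (A *v w) + 2 * inner (A *v v) w"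
    and "inner (v - w) (A *v (v - w)) = inner v (A *v v) + inner w (A *v w) - 2 * inner (A *v v) w"
    by (simp_all add: inner_matrix_sym[OF sym, of v w] inner_add_left inner_add_right inner_diff_left
        inner_diff_right matrix_vector_right_distrib matrix_vector_mult_diff_distrib
        inner_matrix_sym[OF sym, of w v, symmetric] inner_commute[of w "A *v v"] inner_commute[of "A *v w" v])
  with pos[of "v + w"] pos[of "v - w"] le[of v] le[of w] show ?thesis
    by linarith
qed

text \<open>Row sums on the diagonal minus the matrix form the graph Laplacian with weights
  \<open>m i j\<close>; expand the square and use symmetry to merge the two diagonal terms.\<close>

lemma qform_lumped_diff:
  assumes "sym_on N m"
  shows "qform N (\<lambda>i j. (if i = j then \<Sum>k<N. m i k else 0) - m i j) c
    = (\<Sum>i<N. \<Sum>j<N. m i j * (c i - c j)\<^sup>2) / 2"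
proof -
  have diag: "(\<Sum>j<N. c i * (if i = j then \<Sum>k<N. m i k else 0) * c j) = (\<Sum>k<N. m i k * (c i)\<^sup>2)"
    if "i < N" for i
  proof -
    have "(\<Sum>j<N. c i * (if i = j then \<Sum>k<N. m i k else 0) * c j)
        = (\<Sum>j<N. if i = j then c i * (\<Sum>k<N. m i k) * c i else 0)"
      by (intro sum.cong) auto
    then show ?thesis
      using that by (simp add: power2_eq_square sum_distrib_left mult.commute mult.left_commute)
  qed
  have "(\<Sum>i<N. \<Sum>j<N. m i j * (c j)\<^sup>2) = (\<Sum>j<N. \<Sum>i<N. m i j * (c j)\<^sup>2)"
    by (rule sum.swap)
  also have "\<dots> = (\<Sum>i<N. \<Sum>j<N. m i j * (c i)\<^sup>2)"
    using assms by (intro sum.cong refl) (simp add: sym_on_def)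
  finally have "(\<Sum>i<N. \<Sum>j<N. m i j * (c i - c j)\<^sup>2)
      = 2 * (\<Sum>i<N. \<Sum>j<N. m i j * (c i)\<^sup>2) - 2 * (\<Sum>i<N. \<Sum>j<N. c i * m i j * c j)"
    by (simp add: power2_diff algebra_simps sum.distrib sum_subtractf sum_distrib_left)
  then show ?thesis
    using diag by (simp add: qform_def left_diff_distrib right_diff_distrib sum_subtractf)
qed

lemma integral_double_sum:
  fixes f :: "nat \<Rightarrow> nat \<Rightarrow> 'a \<Rightarrow> real"
  assumes "\<And>i j. i < m \<Longrightarrow> j < n \<Longrightarrow> integrable M (f i j)"
  shows "integrable M (\<lambda>x. \<Sum>i<m. \<Sum>j<n. k i j * f i j x)"
    and "(\<integral>x. (\<Sum>i<m. \<Sum>j<n. k i j * f i j x) \<partial>M) = (\<Sum>i<m. \<Sum>j<n. k i j * (\<integral>x. f i j x \<partial>M))"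
proof -
  have int: "integrable M (\<lambda>x. \<Sum>j<n. k i j * f i j x)" if "i < m" for i
    using assms that by (intro Bochner_Integration.integrable_sum integrable_mult_right) auto
  then show "integrable M (\<lambda>x. \<Sum>i<m. \<Sum>j<n. k i j * f i j x)"
    using Bochner_Integration.integrable_sum[of "{..<m}" M "\<lambda>i x. \<Sum>j<n. k i j * f i j x"] by simp
  have "(\<integral>x. (\<Sum>i<m. \<Sum>j<n. k i j * f i j x) \<partial>M) = (\<Sum>i<m. \<integral>x. (\<Sum>j<n. k i j * f i j x) \<partial>M)"
    by (rule Bochner_Integration.integral_sum) (simp add: int)
  also have "\<dots> = (\<Sum>i<m. \<Sum>j<n. k i j * (\<integral>x. f i j x \<partial>M))"
    using assms by (intro sum.cong refl)
      (simp add: Bochner_Integration.integral_sum integrable_mult_right)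
  finally show "(\<integral>x. (\<Sum>i<m. \<Sum>j<n. k i j * f i j x) \<partial>M) = (\<Sum>i<m. \<Sum>j<n. k i j * (\<integral>x. f i j x \<partial>M))" .
qed

section \<open>The nodal basis on a simplicial mesh\<close>

locale finite_elements =
  fixes \<Omega> :: "(real^'d) set" and \<T> and N :: nat and \<phi> :: "nat \<Rightarrow> real^'d \<Rightarrow> real"
    and z :: "nat \<Rightarrow> real^'d"
  assumes domain: "polyhedral_domain \<Omega>" and mesh: "mesh_of \<Omega> \<T>"
    and nodes: "bij_betw z {..<N} (interior_nodes \<Omega> \<T>)"
    and P1: "\<And>i. i < N \<Longrightarrow> \<phi> i \<in> P1_space \<Omega> \<T>"
    and nodal: "\<And>i j. i < N \<Longrightarrow> j < N \<Longrightarrow> \<phi> i (z j) = (if i = j then 1 else 0)"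
begin

lemma open_domain: "open \<Omega>" and bounded_domain: "bounded \<Omega>"
  and nonempty_domain: "\<Omega> \<noteq> {}" and connected_domain: "connected \<Omega>"
  using domain by (auto simp: polyhedral_domain_def)

lemma finite_mesh: "finite \<T>" and Union_mesh: "\<Union>\<T> = closure \<Omega>"
  using mesh by (auto simp: mesh_of_def triangulation_def)

lemma simplex_mesh: "K \<in> \<T> \<Longrightarrow> int CARD('d) simplex K"
  using mesh by (auto simp: mesh_of_def)

lemma node_in_domain: "i < N \<Longrightarrow> z i \<in> \<Omega>"
  using nodes by (auto simp: bij_betw_def interior_nodes_def)

lemma element:
  assumes "K \<in> \<T>"
  shows "convex K" and "compact K" and "interior K \<noteq> {}"
    and "finite {v. v extreme_point_of K}" and "K = convex hull {v. v extreme_point_of K}"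
proof -
  obtain C where C: "finite C" "K = convex hull C"
    using simplex_mesh[OF assms] by (auto simp: simplex)
  show K: "convex K" "compact K"
    using C by (auto intro: finite_imp_compact_convex_hull)
  show "finite {v. v extreme_point_of K}"
    using C by (auto intro: finite_subset[of _ C] dest: extreme_point_of_convex_hull)
  show "K = convex hull {v. v extreme_point_of K}"
    using C Krein_Milman_polytope[of C] by simp
  \<comment> \<open>In full dimension the relative interior, nonempty by convexity, is the
    interior.\<close>
  have "aff_dim K = int DIM(real^'d)"
    using simplex_mesh[OF assms] aff_dim_simplex by simp
  moreover from this have "K \<noteq> {}"
    by (cases "K = {}") auto
  ultimately show "interior K \<noteq> {}"
    using K by (simp add: interior_rel_interior_gen rel_interior_eq_empty)
qed

text \<open>A vertex inside the domain is one of the nodes. Any other vertex lies on the frontier,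
  where the basis vanishes and no node is found.\<close>

lemma basis_at_vertex:
  assumes K: "K \<in> \<T>" and v: "v extreme_point_of K" and i: "i < N"
  shows "\<phi> i v = (if v = z i then 1 else 0)"
proof (cases "v \<in> \<Omega>")
  case True
  then have "v \<in> interior_nodes \<Omega> \<T>"
    using K v by (auto simp: interior_nodes_def)
  then obtain j where j: "j < N" "v = z j"
    using nodes by (auto simp: bij_betw_def)
  then have "v = z i \<longleftrightarrow> i = j"
    using nodes i by (auto simp: bij_betw_def inj_on_def)
  then show ?thesis
    using nodal[OF i j(1)] j by simp
next
  case False
  have "v \<in> closure \<Omega>"
    using K v Union_mesh by (auto simp: extreme_point_of_def)
  then have "v \<in> frontier \<Omega>"
    using False open_domain by (simp add: frontier_def interior_open)
  then show ?thesis
    using P1[OF i] False node_in_domain[OF i] by (auto simp: P1_space_def)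
qed

lemma basis_affine:
  assumes "i < N" "K \<in> \<T>"
  obtains c g where "\<And>x. x \<in> K \<Longrightarrow> \<phi> i x = c + inner g x"
  using P1[OF assms(1)] assms(2) unfolding P1_space_def by blast

text \<open>An affine function is determined by its vertex values, so at \<open>x\<close> each basis
  function is the barycentric weight of its node, or 0 if the node is not a vertex of
  \<open>K\<close>. Nonnegativity, the bound on the sum and the support property all follow from
  this.\<close>

lemma basis_barycentric:
  assumes K: "K \<in> \<T>" and x: "x \<in> K"
  obtains S t where "finite S" "S \<subseteq> K" "\<And>v. v \<in> S \<Longrightarrow> 0 \<le> t v" "sum t S = (1::real)"
    "\<And>i. i < N \<Longrightarrow> \<phi> i x = (if z i \<in> S then t (z i) else 0)"
proof -
  define S where "S = {v. v extreme_point_of K}"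
  have S: "finite S" "K = convex hull S"
    unfolding S_def using element[OF K] by blast+
  obtain t where t: "\<forall>v\<in>S. 0 \<le> t v" "sum t S = 1" "(\<Sum>v\<in>S. t v *\<^sub>R v) = x"
    using x unfolding S(2) convex_hull_finite[OF S(1)] by blast
  have SK: "S \<subseteq> K"
    by (auto simp: S_def extreme_point_of_def)
  have "\<phi> i x = (if z i \<in> S then t (z i) else 0)" if i: "i < N" for i
  proof -
    obtain c g where cg: "\<And>y. y \<in> K \<Longrightarrow> \<phi> i y = c + inner g y"
      using basis_affine[OF i K] by blast
    have "\<phi> i x = c + inner g (\<Sum>v\<in>S. t v *\<^sub>R v)"
      using cg[OF x] t(3) by simp
    also have "\<dots> = c * sum t S + (\<Sum>v\<in>S. t v * inner g v)"
      by (simp add: t(2) inner_sum_right)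
    also have "\<dots> = (\<Sum>v\<in>S. t v * (c + inner g v))"
      by (simp add: sum_distrib_left sum.distrib algebra_simps)
    also have "\<dots> = (\<Sum>v\<in>S. if z i = v then t v else 0)"
      using basis_at_vertex[OF K _ i] cg SK by (intro sum.cong) (auto simp: S_def subset_iff)
    finally show ?thesis
      using S(1) by simp
  qed
  then show thesis
    using that[of S t] S SK t by blast
qed

lemma basis_nonneg: "x \<in> closure \<Omega> \<Longrightarrow> i < N \<Longrightarrow> 0 \<le> \<phi> i x"
  using Union_mesh by (metis UnionE basis_barycentric order_refl)

text \<open>Equality can fail because the barycentric weights of frontier vertices are missing from
  the sum.\<close>

lemma basis_sum_le_1:
  assumes "x \<in> closure \<Omega>"
  shows "(\<Sum>i<N. \<phi> i x) \<le> 1"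
proof -
  obtain K where "K \<in> \<T>" "x \<in> K"
    using assms Union_mesh by blast
  then obtain S t where S: "finite S" "\<And>v. v \<in> S \<Longrightarrow> 0 \<le> t v" "sum t S = (1::real)"
    "\<And>i. i < N \<Longrightarrow> \<phi> i x = (if z i \<in> S then t (z i) else 0)"
    using basis_barycentric[of K x] by metis
  have inj: "inj_on z {i. i < N \<and> z i \<in> S}"
    using nodes by (auto simp: bij_betw_def inj_on_def)
  have "(\<Sum>i<N. \<phi> i x) = (\<Sum>i<N. if z i \<in> S then t (z i) else 0)"
    using S(4) by simp
  also have "\<dots> = (\<Sum>i\<in>{i. i < N \<and> z i \<in> S}. t (z i))"
    by (subst sum.inter_filter[symmetric]) auto
  also have "\<dots> = sum t (z ` {i. i < N \<and> z i \<in> S})"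
    using inj by (simp add: sum.reindex)
  also have "\<dots> \<le> sum t S"
    using S by (intro sum_mono2) auto
  finally show ?thesis using S by simp
qed

lemma basis_le_1:
  assumes "x \<in> closure \<Omega>" "i < N"
  shows "\<phi> i x \<le> 1"
proof -
  have "\<phi> i x \<le> (\<Sum>i<N. \<phi> i x)"
    using assms basis_nonneg by (intro member_le_sum) auto
  with basis_sum_le_1[OF assms(1)] show ?thesis by linarith
qed

lemma basis_support:
  assumes "K \<in> \<T>" "x \<in> K" "i < N" "\<phi> i x \<noteq> 0"
  shows "z i \<in> K"
  using assms by (metis basis_barycentric subsetD)

section \<open>Discrete functions and their piecewise gradients\<close>

definition func :: "(nat \<Rightarrow> real) \<Rightarrow> real^'d \<Rightarrow> real" where
  "func c x = (\<Sum>i<N. c i * \<phi> i x)"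

text \<open>Defined through the basis, so that the stiffness form expands entrywise at every point;
  in the element interiors it is the gradient of \<open>func c\<close>.\<close>

definition grad :: "(nat \<Rightarrow> real) \<Rightarrow> real^'d \<Rightarrow> real^'d" where
  "grad c x = (\<Sum>i<N. c i *\<^sub>R gradient (\<phi> i) x)"

lemma func_node: "j < N \<Longrightarrow> func c (z j) = c j"
  by (simp add: func_def nodal if_distrib[of "(*) _"] cong: if_cong)

lemma grad_piecewise:
  assumes "K \<in> \<T>"
  obtains k g where "\<And>x. x \<in> K \<Longrightarrow> func c x = k + inner g x" "\<And>x. x \<in> interior K \<Longrightarrow> grad c x = g"
proof -
  have "\<forall>i. \<exists>k g. i < N \<longrightarrow> (\<forall>x\<in>K. \<phi> i x = k + inner g x)"
    using basis_affine[OF _ assms] by metis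
  then obtain k g where kg: "\<And>i x. i < N \<Longrightarrow> x \<in> K \<Longrightarrow> \<phi> i x = k i + inner (g i) x"
    by metis
  have "gradient (\<phi> i) x = g i" if "i < N" "x \<in> interior K" for i x
    using gradient_affine[OF that(2) kg[OF that(1)]] .
  then have "grad c x = (\<Sum>i<N. c i *\<^sub>R g i)" if "x \<in> interior K" for x
    using that by (simp add: grad_def)
  moreover have "func c x = (\<Sum>i<N. c i * k i) + inner (\<Sum>i<N. c i *\<^sub>R g i) x" if "x \<in> K" for x
    using that kg by (simp add: func_def inner_sum_left sum.distrib distrib_left)
  ultimately show thesis
    using that by blast
qed

text \<open>Only nodes of the element containing \<open>x\<close> contribute, and there the nodal differences
  are at most the meshsize times the gradient.\<close>

lemma lumping_defect_pointwise:
  assumes K: "K \<in> \<T>" and x: "x \<in> interior K"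
  shows "(\<Sum>i<N. \<Sum>j<N. \<phi> i x * \<phi> j x * (c i - c j)\<^sup>2) \<le> (meshsize \<T>)\<^sup>2 * (norm (grad c x))\<^sup>2"
proof -
  let ?B = "(meshsize \<T>)\<^sup>2 * (norm (grad c x))\<^sup>2"
  have xK: "x \<in> K" and xc: "x \<in> closure \<Omega>"
    using x K interior_subset Union_mesh by blast+
  obtain k g where kg: "\<And>y. y \<in> K \<Longrightarrow> func c y = k + inner g y" "\<And>y. y \<in> interior K \<Longrightarrow> grad c y = g"
    using grad_piecewise[OF K, of c] by blast
  have "\<phi> i x * \<phi> j x * (c i - c j)\<^sup>2 \<le> \<phi> i x * \<phi> j x * ?B" if ij: "i < N" "j < N" for i j
  proof (cases "\<phi> i x = 0 \<or> \<phi> j x = 0")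
    case False
    then have zK: "z i \<in> K" "z j \<in> K"
      using basis_support[OF K xK] ij by auto
    have "c i - c j = inner g (z i - z j)"
      using kg(1)[OF zK(1)] kg(1)[OF zK(2)] ij by (simp add: func_node inner_diff_right)
    then have "\<bar>c i - c j\<bar> \<le> norm g * dist (z i) (z j)"
      by (simp add: dist_norm Cauchy_Schwarz_ineq2)
    also have "\<dots> \<le> norm g * meshsize \<T>"
    proof (rule mult_left_mono)
      have "dist (z i) (z j) \<le> diameter K"
        using element[OF K] zK by (intro diameter_bounded_bound compact_imp_bounded)
      also have "\<dots> \<le> meshsize \<T>"
        unfolding meshsize_def using finite_mesh K by (intro Max_ge) auto
      finally show "dist (z i) (z j) \<le> meshsize \<T>" .
    qed simp
    finally have "(c i - c j)\<^sup>2 \<le> (norm g * meshsize \<T>)\<^sup>2"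
      by (metis abs_ge_zero power2_abs power_mono)
    then have "(c i - c j)\<^sup>2 \<le> ?B"
      using kg(2)[OF x] by (simp add: power_mult_distrib mult.commute)
    then show ?thesis
      using basis_nonneg[OF xc] ij by (intro mult_left_mono) auto
  qed auto
  then have "(\<Sum>i<N. \<Sum>j<N. \<phi> i x * \<phi> j x * (c i - c j)\<^sup>2) \<le> (\<Sum>i<N. \<Sum>j<N. \<phi> i x * \<phi> j x * ?B)"
    by (intro sum_mono) auto
  \<comment> \<open>The weights add up to the square of a number between 0 and 1, so the common
    bound \<open>?B\<close> survives without a constant.\<close>
  also have "\<dots> = (\<Sum>i<N. \<Sum>j<N. \<phi> i x * \<phi> j x) * ?B"
    by (simp only: sum_distrib_right)
  also have "\<dots> = (\<Sum>i<N. \<phi> i x)\<^sup>2 * ?B"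
    by (simp only: power2_eq_square[of "\<Sum>i<N. \<phi> i x"] sum_product)
  also have "\<dots> \<le> 1 * ?B"
    using basis_sum_le_1[OF xc] basis_nonneg[OF xc]
    by (intro mult_right_mono power_le_one sum_nonneg) auto
  finally show ?thesis by simp
qed

section \<open>Measurability and integrability over the domain\<close>

abbreviation \<mu> where "\<mu> \<equiv> lebesgue_on \<Omega>"

lemma domain_sets: "\<Omega> \<in> sets lebesgue"
  using open_domain by simp

lemma set_lebesgue_integral_domain: "(LINT x:\<Omega>|lebesgue. f x) = integral\<^sup>L \<mu> (f :: _ \<Rightarrow> real)"
  using domain_sets by (simp add: set_lebesgue_integral_def integral_restrict_space)

lemma finite_measure_domain: "finite_measure \<mu>"
proof
  have "emeasure lebesgue \<Omega> < \<infinity>"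
    using fmeasurableD2[OF lmeasurable_open[OF bounded_domain open_domain]] by (simp add: top.not_eq_extremum)
  then show "emeasure \<mu> (space \<mu>) \<noteq> \<infinity>"
    using domain_sets by (simp add: emeasure_restrict_space space_restrict_space)
qed

text \<open>The elements cover the domain, and the frontiers of finitely many convex sets form a
  null set.\<close>

lemma AE_element_interior: "AE x in \<mu>. \<exists>K\<in>\<T>. x \<in> interior K"
proof -
  have "negligible (\<Union>K\<in>\<T>. frontier K)"
    using finite_mesh element(1) by (auto intro!: negligible_Union negligible_convex_frontier)
  then have "AE x in lebesgue. x \<notin> (\<Union>K\<in>\<T>. frontier K)"
    by (intro AE_not_in) (simp add: negligible_iff_null_sets)
  then have "AE x in lebesgue. x \<in> \<Omega> \<longrightarrow> (\<exists>K\<in>\<T>. x \<in> interior K)"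
  proof eventually_elim
    case (elim x)
    show ?case
    proof
      assume "x \<in> \<Omega>"
      then obtain K where "K \<in> \<T>" "x \<in> K"
        using Union_mesh closure_subset[of \<Omega>] by blast
      then show "\<exists>K\<in>\<T>. x \<in> interior K"
        using elim closure_subset[of K] by (auto simp: frontier_def)
    qed
  qed
  then show ?thesis
    using domain_sets by (simp add: AE_restrict_space_iff)
qed

lemma basis_measurable: "i < N \<Longrightarrow> \<phi> i \<in> borel_measurable \<mu>"
  using P1[of i] domain_sets continuous_on_subset[OF _ closure_subset[of \<Omega>]]
  unfolding P1_space_def by (blast intro: continuous_imp_measurable_on_sets_lebesgue)

lemma gradient_constant:
  assumes "i < N" "K \<in> \<T>" "x \<in> interior K" "y \<in> interior K"
  shows "gradient (\<phi> i) x = gradient (\<phi> i) y"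
proof -
  obtain c g where "\<And>x. x \<in> K \<Longrightarrow> \<phi> i x = c + inner g x"
    using basis_affine[OF assms(1,2)] by blast
  then show ?thesis
    using gradient_affine[OF assms(3), of "\<phi> i" c g] gradient_affine[OF assms(4), of "\<phi> i" c g] by simp
qed

text \<open>The gradient is constant on each element interior, so any preimage is an open set up to
  a part of the mesh faces. That part is null, hence Lebesgue measurable by completeness, whatever
  the description yields there.\<close>

lemma gradient_measurable:
  assumes i: "i < N"
  shows "gradient (\<phi> i) \<in> borel_measurable \<mu>"
proof (rule borel_measurableI)
  fix S :: "(real^'d) set"
  define U where "U = (\<Union>K\<in>\<T>. interior K)"
  define V where "V = \<Union>{interior K | K. K \<in> \<T> \<and> (\<forall>x\<in>interior K. gradient (\<phi> i) x \<in> S)}"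
  have "gradient (\<phi> i) -` S \<inter> U = V"
  proof (intro equalityI subsetI)
    fix x assume "x \<in> gradient (\<phi> i) -` S \<inter> U"
    then obtain K where K: "K \<in> \<T>" "x \<in> interior K" and S: "gradient (\<phi> i) x \<in> S"
      by (auto simp: U_def)
    have "\<forall>y\<in>interior K. gradient (\<phi> i) y \<in> S"
      using gradient_constant[OF i K(1) _ K(2)] S by metis
    with K show "x \<in> V"
      unfolding V_def by blast
  qed (auto simp: U_def V_def)
  then have eq: "gradient (\<phi> i) -` S \<inter> space \<mu> = (V \<inter> \<Omega>) \<union> (gradient (\<phi> i) -` S \<inter> (\<Omega> - U))"
    unfolding space_restrict_space by auto
  have "open V"
    unfolding V_def by auto
  then have "V \<inter> \<Omega> \<in> sets lebesgue"
    using open_domain by (auto intro: open_Int)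
  moreover have "gradient (\<phi> i) -` S \<inter> (\<Omega> - U) \<in> sets lebesgue"
  proof -
    have "negligible (\<Union>K\<in>\<T>. frontier K)"
      using finite_mesh element(1) by (auto intro!: negligible_Union negligible_convex_frontier)
    moreover have "gradient (\<phi> i) -` S \<inter> (\<Omega> - U) \<subseteq> (\<Union>K\<in>\<T>. frontier K)"
    proof
      fix x assume x: "x \<in> gradient (\<phi> i) -` S \<inter> (\<Omega> - U)"
      then obtain K where "K \<in> \<T>" "x \<in> K"
        using Union_mesh closure_subset[of \<Omega>] by blast
      with x show "x \<in> (\<Union>K\<in>\<T>. frontier K)"
        using closure_subset[of K] by (auto simp: U_def frontier_def)
    qed
    ultimately have "negligible (gradient (\<phi> i) -` S \<inter> (\<Omega> - U))"
      by (rule negligible_subset)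
    then show ?thesis
      by (rule negligible_imp_sets)
  qed
  ultimately show "gradient (\<phi> i) -` S \<inter> space \<mu> \<in> sets \<mu>"
    using domain_sets unfolding eq by (auto simp: sets_restrict_space_iff)
qed

lemma gradient_bounded:
  assumes "i < N"
  obtains b where "AE x in \<mu>. norm (gradient (\<phi> i) x) \<le> b"
proof
  \<comment> \<open>One sample point per element represents its constant gradient; the sum over the
    finite mesh dominates every summand.\<close>
  let ?n = "\<lambda>K. norm (gradient (\<phi> i) (SOME x. x \<in> interior K))"
  show "AE x in \<mu>. norm (gradient (\<phi> i) x) \<le> (\<Sum>K\<in>\<T>. ?n K)"
    using AE_element_interior
  proof eventually_elim
    case (elim x)
    then obtain K where K: "K \<in> \<T>" "x \<in> interior K" by blast
    then have "norm (gradient (\<phi> i) x) = ?n K"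
      using gradient_constant[OF assms K(1,2)] someI[of "\<lambda>x. x \<in> interior K"] by metis
    also have "\<dots> \<le> (\<Sum>K\<in>\<T>. ?n K)"
      using K(1) finite_mesh by (intro member_le_sum) auto
    finally show ?case .
  qed
qed

lemma integrable_mass:
  assumes "i < N" "j < N"
  shows "integrable \<mu> (\<lambda>x. \<phi> i x * \<phi> j x)"
proof (rule finite_measure.integrable_const_bound[OF finite_measure_domain])
  show "AE x in \<mu>. norm (\<phi> i x * \<phi> j x) \<le> 1"
  proof (rule AE_I2)
    fix x assume "x \<in> space \<mu>"
    then have "x \<in> closure \<Omega>"
      using closure_subset by (auto simp: space_restrict_space)
    then have "0 \<le> \<phi> i x" "0 \<le> \<phi> j x" "\<phi> i x \<le> 1" "\<phi> j x \<le> 1"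
      using basis_nonneg basis_le_1 assms by auto
    then show "norm (\<phi> i x * \<phi> j x) \<le> 1"
      using mult_le_one[of "\<phi> i x" "\<phi> j x"] by simp
  qed
qed (use assms basis_measurable in measurable)

lemma integrable_stiffness:
  assumes a: "diffusion_coefficient \<Omega> a" and ij: "i < N" "j < N"
  shows "integrable \<mu> (\<lambda>x. inner (a x *v gradient (\<phi> i) x) (gradient (\<phi> j) x))"
proof -
  obtain \<alpha> \<beta> where \<alpha>: "0 < \<alpha>"
    "\<And>x \<xi>. x \<in> \<Omega> \<Longrightarrow> \<alpha> * (norm \<xi>)\<^sup>2 \<le> inner \<xi> (a x *v \<xi>)"
    "\<And>x \<xi>. x \<in> \<Omega> \<Longrightarrow> inner \<xi> (a x *v \<xi>) \<le> \<beta> * (norm \<xi>)\<^sup>2"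
    using diffusion_coefficient_bounds[OF a] by blast
  \<comment> \<open>Passing to the absolute value makes the bound monotone in the gradient
    norms.\<close>
  have \<beta>: "inner \<xi> (a x *v \<xi>) \<le> \<bar>\<beta>\<bar> * (norm \<xi>)\<^sup>2" if "x \<in> \<Omega>" for x \<xi>
    using \<alpha>(3)[OF that, of \<xi>] mult_right_mono[OF abs_ge_self[of \<beta>], of "(norm \<xi>)\<^sup>2"] by simp
  have pos: "0 \<le> inner \<xi> (a x *v \<xi>)" if "x \<in> \<Omega>" for x \<xi>
    using \<alpha>(1) \<alpha>(2)[OF that, of \<xi>] by (meson less_imp_le mult_nonneg_nonneg order_trans zero_le_power2)
  obtain bi bj where b: "AE x in \<mu>. norm (gradient (\<phi> i) x) \<le> bi" "AE x in \<mu>. norm (gradient (\<phi> j) x) \<le> bj"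
    using gradient_bounded ij by metis
  have "AE x in \<mu>. norm (inner (a x *v gradient (\<phi> i) x) (gradient (\<phi> j) x)) \<le> \<bar>\<beta>\<bar> * bi\<^sup>2 + \<bar>\<beta>\<bar> * bj\<^sup>2"
    using b AE_space
  proof eventually_elim
    case (elim x)
    then have x: "x \<in> \<Omega>" by (simp add: space_restrict_space)
    have "transpose (a x) = a x"
      using a x by (simp add: diffusion_coefficient_def)
    from inner_matrix_bound[OF this pos[OF x] \<beta>[OF x], of "gradient (\<phi> i) x" "gradient (\<phi> j) x"]
    have "2 * \<bar>inner (a x *v gradient (\<phi> i) x) (gradient (\<phi> j) x)\<bar>
        \<le> \<bar>\<beta>\<bar> * (norm (gradient (\<phi> i) x))\<^sup>2 + \<bar>\<beta>\<bar> * (norm (gradient (\<phi> j) x))\<^sup>2" .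
    also have "\<dots> \<le> \<bar>\<beta>\<bar> * bi\<^sup>2 + \<bar>\<beta>\<bar> * bj\<^sup>2"
      using elim by (intro add_mono mult_left_mono power_mono) auto
    finally show ?case by simp
  qed
  moreover have "(\<lambda>x. inner (a x *v gradient (\<phi> i) x) (gradient (\<phi> j) x)) \<in> borel_measurable \<mu>"
  proof -
    \<comment> \<open>The integrand is a continuous function of the matrix and the two gradients,
      composed with a measurable triple.\<close>
    have "(\<lambda>p :: (real^'d^'d) \<times> (real^'d) \<times> (real^'d). inner (fst p *v fst (snd p)) (snd (snd p))) \<in> borel_measurable borel"
      unfolding matrix_vector_mult_def
      by (intro borel_measurable_continuous_onI continuous_intros continuous_on_vec_lambda)
    moreover have "(\<lambda>x. (a x, gradient (\<phi> i) x, gradient (\<phi> j) x)) \<in> borel_measurable \<mu>"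
      using a gradient_measurable ij
      by (intro borel_measurable_Pair) (auto simp: diffusion_coefficient_def)
    ultimately show ?thesis
      by (auto dest: measurable_compose[rotated])
  qed
  ultimately show ?thesis
    by (rule finite_measure.integrable_const_bound[OF finite_measure_domain])
qed

section \<open>Mass, stiffness and lumping defect as quadratic forms\<close>

definition stiff :: "(real^'d \<Rightarrow> real^'d^'d) \<Rightarrow> nat \<Rightarrow> nat \<Rightarrow> real" where
  "stiff a i j = (\<integral>x. inner (a x *v gradient (\<phi> i) x) (gradient (\<phi> j) x) \<partial>\<mu>)"

definition mass :: "nat \<Rightarrow> nat \<Rightarrow> real" where
  "mass i j = (\<integral>x. \<phi> i x * \<phi> j x \<partial>\<mu>)"

lemma sym_mass: "sym_on N mass"
  by (simp add: sym_on_def mass_def mult.commute)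

lemma sym_stiff:
  assumes "diffusion_coefficient \<Omega> a"
  shows "sym_on N (stiff a)"
  unfolding sym_on_def stiff_def
proof (intro allI impI Bochner_Integration.integral_cong refl)
  fix i j x assume "x \<in> space \<mu>"
  then have "transpose (a x) = a x"
    using assms by (simp add: diffusion_coefficient_def space_restrict_space)
  then show "inner (a x *v gradient (\<phi> i) x) (gradient (\<phi> j) x) = inner (a x *v gradient (\<phi> j) x) (gradient (\<phi> i) x)"
    using inner_matrix_sym by (metis inner_commute)
qed

lemma qform_stiff:
  assumes a: "diffusion_coefficient \<Omega> a"
  shows "qform N (stiff a) c = (\<integral>x. inner (a x *v grad c x) (grad c x) \<partial>\<mu>)"
    and "integrable \<mu> (\<lambda>x. inner (a x *v grad c x) (grad c x))"
proof -
  have *: "inner (a x *v grad c x) (grad c x)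
      = (\<Sum>i<N. \<Sum>j<N. c i * c j * inner (a x *v gradient (\<phi> i) x) (gradient (\<phi> j) x))" for x
    by (simp add: grad_def inner_sum_left inner_sum_right linear_sum[OF matrix_vector_mul_linear]
        matrix_vector_mult_scaleR sum_distrib_left mult.assoc)
      (subst sum.swap, simp add: mult.left_commute)
  show "qform N (stiff a) c = (\<integral>x. inner (a x *v grad c x) (grad c x) \<partial>\<mu>)"
    unfolding * qform_def stiff_def
    by (subst integral_double_sum(2)) (auto intro: integrable_stiffness[OF a] simp: mult.assoc mult.left_commute mult.commute)
  show "integrable \<mu> (\<lambda>x. inner (a x *v grad c x) (grad c x))"
    unfolding * by (rule integral_double_sum(1)) (rule integrable_stiffness[OF a])
qed

lemma integrable_norm_grad:
  "integrable \<mu> (\<lambda>x. (norm (grad c x))\<^sup>2)"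
proof -
  have "\<exists>b. AE x in \<mu>. norm (gradient (\<phi> i) x) \<le> b" if "i < N" for i
    using gradient_bounded[OF that] by blast
  then obtain b where "\<And>i. i < N \<Longrightarrow> AE x in \<mu>. norm (gradient (\<phi> i) x) \<le> b i"
    by metis
  then have "AE x in \<mu>. \<forall>i\<in>{..<N}. norm (gradient (\<phi> i) x) \<le> b i"
    by (intro AE_finite_allI) auto
  then have "AE x in \<mu>. norm ((norm (grad c x))\<^sup>2) \<le> (\<Sum>i<N. \<bar>c i\<bar> * b i)\<^sup>2"
  proof eventually_elim
    case (elim x)
    have "norm (grad c x) \<le> (\<Sum>i<N. \<bar>c i\<bar> * b i)"
      unfolding grad_def using elim by (intro sum_norm_le) (auto intro: mult_left_mono)
    then show ?case
      by (simp add: power_mono)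
  qed
  moreover have "(\<lambda>x. (norm (grad c x))\<^sup>2) \<in> borel_measurable \<mu>"
    unfolding grad_def using gradient_measurable by measurable
  ultimately show ?thesis
    by (rule finite_measure.integrable_const_bound[OF finite_measure_domain])
qed

lemma qform_stiff_coercive:
  assumes a: "diffusion_coefficient \<Omega> a"
    and \<alpha>: "\<And>x \<xi>. x \<in> \<Omega> \<Longrightarrow> \<alpha> * (norm \<xi>)\<^sup>2 \<le> inner \<xi> (a x *v \<xi>)"
  shows "\<alpha> * (\<integral>x. (norm (grad c x))\<^sup>2 \<partial>\<mu>) \<le> qform N (stiff a) c"
proof -
  have "\<alpha> * (\<integral>x. (norm (grad c x))\<^sup>2 \<partial>\<mu>) = (\<integral>x. \<alpha> * (norm (grad c x))\<^sup>2 \<partial>\<mu>)"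
    by simp
  also have "\<dots> \<le> (\<integral>x. inner (a x *v grad c x) (grad c x) \<partial>\<mu>)"
    using \<alpha> by (intro integral_mono integrable_mult_right integrable_norm_grad qform_stiff(2)[OF a])
      (simp add: inner_commute space_restrict_space)
  finally show ?thesis
    by (simp add: qform_stiff(1)[OF a])
qed

text \<open>The entries of lumped minus consistent mass matrix, in the shape of
  \<open>qform_lumped_diff\<close>.\<close>

definition defect :: "nat \<Rightarrow> nat \<Rightarrow> real" where
  "defect i j = (if i = j then \<Sum>k<N. mass i k else 0) - mass i j"

lemma qform_defect:
  "qform N defect c = (\<Sum>i<N. \<Sum>j<N. mass i j * (c i - c j)\<^sup>2) / 2"
  unfolding defect_def by (rule qform_lumped_diff[OF sym_mass])

lemma qform_defect_nonneg: "0 \<le> qform N defect c"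
proof -
  have "0 \<le> mass i j" if "i < N" "j < N" for i j
    unfolding mass_def using that basis_nonneg closure_subset[of \<Omega>]
    by (intro integral_nonneg_AE AE_I2) (auto simp: space_restrict_space)
  then show ?thesis
    unfolding qform_defect by (auto intro!: sum_nonneg)
qed

text \<open>Integrates \<open>lumping_defect_pointwise\<close>, which holds almost everywhere
  because the mesh faces are null.\<close>

lemma qform_defect_le:
  "2 * qform N defect c \<le> (meshsize \<T>)\<^sup>2 * (\<integral>x. (norm (grad c x))\<^sup>2 \<partial>\<mu>)"
proof -
  have eq: "(\<Sum>i<N. \<Sum>j<N. \<phi> i x * \<phi> j x * (c i - c j)\<^sup>2)
      = (\<Sum>i<N. \<Sum>j<N. (c i - c j)\<^sup>2 * (\<phi> i x * \<phi> j x))" for x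
    by (simp add: mult.commute)
  have "2 * qform N defect c = (\<Sum>i<N. \<Sum>j<N. (c i - c j)\<^sup>2 * (\<integral>x. \<phi> i x * \<phi> j x \<partial>\<mu>))"
    by (simp add: qform_defect mass_def mult.commute)
  also have "\<dots> = (\<integral>x. (\<Sum>i<N. \<Sum>j<N. \<phi> i x * \<phi> j x * (c i - c j)\<^sup>2) \<partial>\<mu>)"
    unfolding eq by (rule integral_double_sum(2)[symmetric]) (rule integrable_mass)
  also have "\<dots> \<le> (\<integral>x. (meshsize \<T>)\<^sup>2 * (norm (grad c x))\<^sup>2 \<partial>\<mu>)"
  proof (rule integral_mono_AE)
    show "AE x in \<mu>. (\<Sum>i<N. \<Sum>j<N. \<phi> i x * \<phi> j x * (c i - c j)\<^sup>2) \<le> (meshsize \<T>)\<^sup>2 * (norm (grad c x))\<^sup>2"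
      using AE_element_interior by eventually_elim (use lumping_defect_pointwise in blast)
    show "integrable \<mu> (\<lambda>x. \<Sum>i<N. \<Sum>j<N. \<phi> i x * \<phi> j x * (c i - c j)\<^sup>2)"
      unfolding eq by (rule integral_double_sum(1)) (rule integrable_mass)
  qed (rule integrable_mult_right, rule integrable_norm_grad)
  finally show ?thesis by simp
qed

text \<open>A discrete function with vanishing gradient takes finitely many values, so it is constant
  on the connected closure of the domain.\<close>

lemma grad_zero_imp_zero:
  assumes "(\<integral>x. (norm (grad c x))\<^sup>2 \<partial>\<mu>) \<le> 0" and i: "i < N"
  shows "c i = 0"
proof -
  have "0 \<le> (\<integral>x. (norm (grad c x))\<^sup>2 \<partial>\<mu>)"
    by simp
  with assms(1) have "(\<integral>x. (norm (grad c x))\<^sup>2 \<partial>\<mu>) = 0"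
    by linarith
  then have "AE x in \<mu>. (norm (grad c x))\<^sup>2 = 0"
    using integral_nonneg_eq_0_iff_AE[OF integrable_norm_grad] by simp
  then have "AE x in lebesgue. x \<in> \<Omega> \<longrightarrow> grad c x = 0"
    using domain_sets by (simp add: AE_restrict_space_iff)
  then obtain Z where Z: "{x. \<not> (x \<in> \<Omega> \<longrightarrow> grad c x = 0)} \<subseteq> Z" "negligible Z"
    by (auto simp: eventually_ae_filter negligible_iff_null_sets)
  have const: "\<exists>k. \<forall>x\<in>K. func c x = k" if K: "K \<in> \<T>" for K
  proof -
    obtain k g where kg: "\<And>x. x \<in> K \<Longrightarrow> func c x = k + inner g x" "\<And>x. x \<in> interior K \<Longrightarrow> grad c x = g"
      using grad_piecewise[OF K, of c] by blast
    \<comment> \<open>The interior of \<open>K\<close> lies in the closure of the domain; being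
      open, it meets the domain itself. A nonempty open set does not fit into the null set
      \<open>Z\<close>, which forces \<open>g = 0\<close>.\<close>
    have "interior K \<inter> closure \<Omega> \<noteq> {}"
      using element(3)[OF K] interior_subset[of K] K Union_mesh by blast
    then have W: "open (interior K \<inter> \<Omega>)" "interior K \<inter> \<Omega> \<noteq> {}"
      using open_domain open_Int_closure_eq_empty[OF open_interior, of K \<Omega>] by auto
    have "g = 0"
    proof (rule ccontr)
      assume "g \<noteq> 0"
      then have "interior K \<inter> \<Omega> \<subseteq> Z"
        using kg(2) Z(1) by auto
      then show False
        using W open_not_negligible negligible_subset[OF Z(2)] by blast
    qed
    then show ?thesis using kg(1) by auto
  qed
  then obtain k where k: "\<And>K x. K \<in> \<T> \<Longrightarrow> x \<in> K \<Longrightarrow> func c x = k K"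
    by metis
  have "func c ` closure \<Omega> \<subseteq> k ` \<T>"
    using k unfolding Union_mesh[symmetric] by auto
  then have "finite (func c ` closure \<Omega>)"
    using finite_mesh finite_surj by blast
  moreover have "continuous_on (closure \<Omega>) (func c)"
    unfolding func_def using P1 unfolding P1_space_def by (intro continuous_intros) blast
  ultimately have "func c constant_on closure \<Omega>"
    by (intro continuous_finite_range_constant connected_imp_connected_closure connected_domain)
  then obtain k0 where k0: "\<And>x. x \<in> closure \<Omega> \<Longrightarrow> func c x = k0"
    unfolding constant_on_def by blast
  \<comment> \<open>Only the empty set and the whole space have empty frontier. At a frontier point
    the function vanishes, which identifies the constant as 0.\<close>
  have "frontier \<Omega> \<noteq> {}"
    using nonempty_domain bounded_domain not_bounded_UNIV unfolding frontier_eq_empty by metis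
  then obtain y where y: "y \<in> frontier \<Omega>"
    by blast
  have "func c y = 0"
    unfolding func_def
  proof (rule sum.neutral, rule ballI)
    fix i assume "i \<in> {..<N}"
    then show "c i * \<phi> i y = 0"
      using P1[of i] y by (simp add: P1_space_def)
  qed
  moreover have "y \<in> closure \<Omega>" "z i \<in> closure \<Omega>"
    using y node_in_domain[OF i] closure_subset[of \<Omega>] by (auto simp: frontier_def)
  ultimately have "func c (z i) = 0"
    using k0 by metis
  then show ?thesis
    by (simp add: func_node i)
qed

lemma qform_stiff_definite:
  assumes a: "diffusion_coefficient \<Omega> a" and 0: "qform N (stiff a) c = 0"
  shows "\<forall>i<N. c i = 0"
proof -
  obtain \<alpha> where \<alpha>: "0 < \<alpha>" "\<And>x \<xi>. x \<in> \<Omega> \<Longrightarrow> \<alpha> * (norm \<xi>)\<^sup>2 \<le> inner \<xi> (a x *v \<xi>)"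
    using diffusion_coefficient_bounds[OF a] by metis
  have "\<alpha> * (\<integral>x. (norm (grad c x))\<^sup>2 \<partial>\<mu>) \<le> 0"
    using qform_stiff_coercive[OF a \<alpha>(2), of c] 0 by simp
  then have "(\<integral>x. (norm (grad c x))\<^sup>2 \<partial>\<mu>) \<le> 0"
    using \<alpha>(1) by (simp add: mult_le_0_iff)
  then show ?thesis
    using grad_zero_imp_zero by blast
qed

text \<open>Here the lower bound on \<tau> enters: coercivity turns h^2 times the Dirichlet energy
  into \<tau> times the stiffness form.\<close>

lemma qform_defect_le_stiff:
  assumes a: "diffusion_coefficient \<Omega> a"
    and \<alpha>: "\<And>x \<xi>. x \<in> \<Omega> \<Longrightarrow> \<alpha> * (norm \<xi>)\<^sup>2 \<le> inner \<xi> (a x *v \<xi>)" "0 < \<alpha>"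
    and \<tau>: "(meshsize \<T>)\<^sup>2 \<le> \<tau> * \<alpha>"
  shows "qform N defect c \<le> \<tau> / 2 * qform N (stiff a) c"
proof -
  let ?I = "\<integral>x. (norm (grad c x))\<^sup>2 \<partial>\<mu>"
  have "0 \<le> \<tau> * \<alpha>"
    using \<tau> by (meson order_trans zero_le_power2)
  then have "0 \<le> \<tau>"
    using \<alpha>(2) by (simp add: zero_le_mult_iff)
  have "2 * qform N defect c \<le> (meshsize \<T>)\<^sup>2 * ?I"
    by (rule qform_defect_le)
  also have "\<dots> \<le> \<tau> * \<alpha> * ?I"
    using \<tau> by (intro mult_right_mono) simp_all
  also have "\<dots> \<le> \<tau> * qform N (stiff a) c"
    using qform_stiff_coercive[OF a \<alpha>(1), of c] \<open>0 \<le> \<tau>\<close> by (simp add: mult.assoc mult_left_mono)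
  finally show ?thesis by simp
qed

section \<open>From index functions back to matrices\<close>

lemma mass_matrix_index: "i < N \<Longrightarrow> j < N \<Longrightarrow> mass_matrix \<Omega> N \<phi> $$ (i, j) = mass i j"
  unfolding mass_matrix_def by (simp add: mass_def set_lebesgue_integral_domain)

lemma stiffness_matrix_index: "i < N \<Longrightarrow> j < N \<Longrightarrow> stiffness_matrix \<Omega> a N \<phi> $$ (i, j) = stiff a i j"
  unfolding stiffness_matrix_def by (simp add: stiff_def set_lebesgue_integral_domain)

lemma lumped_index:
  "i < N \<Longrightarrow> j < N \<Longrightarrow> lumped (mass_matrix \<Omega> N \<phi>) $$ (i, j) = (if i = j then \<Sum>k<N. mass i k else 0)"
  by (auto simp: lumped_def mat_diag_def mass_matrix_index[symmetric])
    (auto simp: mass_matrix_def)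

end

section \<open>Choice of the constant and assembly\<close>

theorem corollary2:
  fixes \<Omega> :: "(real^'d) set"
    and a b :: "real^'d \<Rightarrow> real^'d^'d"
    and \<sigma> :: real
  assumes "polyhedral_domain \<Omega>"
    and "diffusion_coefficient \<Omega> a"
    and "diffusion_coefficient \<Omega> b"
  shows "\<exists>C>0. \<forall>\<T> N \<phi> \<tau>.
    mesh_of \<Omega> \<T> \<and> shape_regular \<sigma> \<T> \<and> nodal_basis \<Omega> \<T> N \<phi> \<and> 0 < N \<and>
    0 < \<tau> \<and> C * (meshsize \<T>)\<^sup>2 \<le> \<tau> \<longrightarrow>
    (let M = mass_matrix \<Omega> N \<phi>;
         A = stiffness_matrix \<Omega> a N \<phi>;
         B = stiffness_matrix \<Omega> b N \<phi>;
         \<A> = four_block_mat (\<tau> \<cdot>\<^sub>m A) M M (- (\<tau> \<cdot>\<^sub>m B));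
         \<B> = four_block_mat (\<tau> \<cdot>\<^sub>m A) M (lumped M) (- (\<tau> \<cdot>\<^sub>m B));
         \<rho> = spec_rad (minv \<B> * \<A>)
     in invertible_mat \<B> \<and> \<rho> < 2 \<and> gmres_rate_bounded_by (\<A> * minv \<B>) (\<rho> / 2))"
proof -
  obtain \<alpha> where \<alpha>: "0 < \<alpha>" "\<And>x \<xi>. x \<in> \<Omega> \<Longrightarrow> \<alpha> * (norm \<xi>)\<^sup>2 \<le> inner \<xi> (a x *v \<xi>)"
    using diffusion_coefficient_bounds[OF assms(2)] by metis
  obtain \<beta> where \<beta>: "0 < \<beta>" "\<And>x \<xi>. x \<in> \<Omega> \<Longrightarrow> \<beta> * (norm \<xi>)\<^sup>2 \<le> inner \<xi> (b x *v \<xi>)"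
    using diffusion_coefficient_bounds[OF assms(3)] by metis
  \<comment> \<open>The constant is the reciprocal of the smaller coercivity bound. It is fixed
    before mesh and \<tau> are introduced, hence independent of both.\<close>
  define \<gamma> where "\<gamma> = min \<alpha> \<beta>"
  have \<gamma>: "0 < \<gamma>" "\<gamma> \<le> \<alpha>" "\<gamma> \<le> \<beta>"
    using \<alpha> \<beta> by (auto simp: \<gamma>_def)
  show ?thesis
  proof (intro exI[of _ "1 / \<gamma>"] conjI allI impI)
    show "0 < 1 / \<gamma>" using \<gamma> by simp
    fix \<T> N \<phi> \<tau>
    assume *: "mesh_of \<Omega> \<T> \<and> shape_regular \<sigma> \<T> \<and> nodal_basis \<Omega> \<T> N \<phi> \<and> 0 < N \<and>
      0 < \<tau> \<and> 1 / \<gamma> * (meshsize \<T>)\<^sup>2 \<le> \<tau>"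
    then obtain z where "bij_betw z {..<N} (interior_nodes \<Omega> \<T>)"
      "\<forall>i<N. \<phi> i \<in> P1_space \<Omega> \<T> \<and> (\<forall>j<N. \<phi> i (z j) = (if i = j then 1 else 0))"
      unfolding nodal_basis_def by blast
    then interpret finite_elements \<Omega> \<T> N \<phi> z
      using assms(1) * by unfold_locales auto
    have \<tau>: "0 < \<tau>" and N: "0 < N"
      using * by auto
    have "(meshsize \<T>)\<^sup>2 \<le> \<tau> * \<gamma>"
      using * \<gamma>(1) by (simp add: field_simps)
    then have h: "(meshsize \<T>)\<^sup>2 \<le> \<tau> * \<alpha>" "(meshsize \<T>)\<^sup>2 \<le> \<tau> * \<beta>"
      using mult_left_mono[OF \<gamma>(2) less_imp_le[OF \<tau>]] mult_left_mono[OF \<gamma>(3) less_imp_le[OF \<tau>]] by linarith+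
    define M where "M = mass_matrix \<Omega> N \<phi>"
    define A where "A = stiffness_matrix \<Omega> a N \<phi>"
    define B where "B = stiffness_matrix \<Omega> b N \<phi>"
    define L where "L = lumped M"
    note MABL = M_def A_def B_def L_def
    have carrier: "A \<in> carrier_mat N N" "B \<in> carrier_mat N N" "M \<in> carrier_mat N N" "L \<in> carrier_mat N N"
      by (auto simp: MABL stiffness_matrix_def mass_matrix_def lumped_def mat_diag_def)
    have A: "entries A i j = stiff a i j" and B: "entries B i j = stiff b i j"
      and M: "entries M i j = mass i j" and D: "entries (L - M) i j = defect i j" if "i < N" "j < N" for i j
      using that carrier
      by (auto simp: entries_def MABL stiffness_matrix_index mass_matrix_index lumped_index defect_def)
    have sym_D: "sym_on N defect"
      using sym_mass by (auto simp: sym_on_def defect_def)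
    \<comment> \<open>The identities hold only for indices below \<open>N\<close>, which are all
      that the forms see.\<close>
    have q: "qform N (entries A) = qform N (stiff a)" "qform N (entries B) = qform N (stiff b)"
      "qform N (entries (L - M)) = qform N defect"
      by (intro ext qform_cong A B D; assumption)+
    have s: "sym_on N (entries A) \<longleftrightarrow> sym_on N (stiff a)" "sym_on N (entries B) \<longleftrightarrow> sym_on N (stiff b)"
      "sym_on N (entries M) \<longleftrightarrow> sym_on N mass" "sym_on N (entries (L - M)) \<longleftrightarrow> sym_on N defect"
      by (intro sym_on_cong A B M D; assumption)+
    note precond = lumped_preconditioner[OF carrier N, of \<tau>, unfolded q s,
        OF sym_stiff[OF assms(2)] sym_stiff[OF assms(3)] sym_mass sym_D qform_defect_nonneg
          qform_defect_le_stiff[OF assms(2) \<alpha>(2,1) h(1)] qform_defect_le_stiff[OF assms(3) \<beta>(2,1) h(2)]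
          qform_stiff_definite[OF assms(2)] qform_stiff_definite[OF assms(3)] \<tau>]
    show "let M = mass_matrix \<Omega> N \<phi>;
         A = stiffness_matrix \<Omega> a N \<phi>;
         B = stiffness_matrix \<Omega> b N \<phi>;
         \<A> = four_block_mat (\<tau> \<cdot>\<^sub>m A) M M (- (\<tau> \<cdot>\<^sub>m B));
         \<B> = four_block_mat (\<tau> \<cdot>\<^sub>m A) M (lumped M) (- (\<tau> \<cdot>\<^sub>m B));
         \<rho> = spec_rad (minv \<B> * \<A>)
     in invertible_mat \<B> \<and> \<rho> < 2 \<and> gmres_rate_bounded_by (\<A> * minv \<B>) (\<rho> / 2)"
      using precond unfolding Let_def MABL by blast
  qed
qed

end
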